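(* There are pushout squares of algebraic theories as follows. (i) The square with top morphism $\Psi^2\colon\mathbf{Rack}\to\mathbf{Rack}$, left morphism $\mathrm{id}\colon\mathbf{Rack}\to\mathbf{Sets}$, right morphism ${\supset}\colon\mathbf{Rack}\to\mathbf{Invo}$ and bottom morphism the structure morphism $\mathbf{Sets}\to\mathbf{Invo}$ is a pushout square. (ii) The square with top morphism $\Psi^2\colon\mathbf{Quan}\to\mathbf{Quan}$, left morphism $\mathrm{id}\colon\mathbf{Quan}\to\mathbf{Sets}$, right morphism ${\supset}\colon\mathbf{Quan}\to\mathbf{Kei}$ and bottom morphism the structure morphism $\mathbf{Sets}\to\mathbf{Kei}$ is a pushout square.
   Context: A rack $(R,\rhd)$ is a set $R$ with a binary operation $\rhd$ such that for every $x\in R$ the left multiplication $\ell_x\colon y\mapsto x\rhd y$ is bijective and $x\rhd(y\rhd z)=(x\rhd y)\rhd(x\rhd z)$ for all $y,z\in R$. A quandle is a rack with $x\rhd x=x$ for all $x$. A rack is involutary if $x\rhd(x\rhd y)=y$ for all $x,y$. A kei is an involutary quandle. Morphisms are maps preserving $\rhd$. $\mathbf{Sets},\mathbf{Rack},\mathbf{Quan},\mathbf{Invo},\mathbf{Kei}$ denote both the algebraic (Lawvere) theories of sets, racks, quandles, involutary racks, kei and their categories of models. A morphism of algebraic theories $\mathbf{T}\to\mathbf{T}'$ is written in the direction of the left adjoint; it is the same as a ('forgetful', right-adjoint) functor from $\mathbf{T}'$-models to $\mathbf{T}$-models commuting with the underlying-set functors. Pushouts are taken in the category of algebraic theories. The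 morphisms are given by their right adjoints: $\Psi^2$ by $(R,\rhd)\mapsto(R,\rhd^2)$ with $x\rhd^2y=\ell_x^2(y)=x\rhd(x\rhd y)$ (which preserves racks and quandles); the morphisms $\mathrm{id}$ to $\mathbf{Sets}$ by equipping a set with the trivial structure $x\rhd y=y$; the morphisms $\supset$ by the inclusions of involutary racks into racks and of kei into quandles; the structure morphism $\mathbf{Sets}\to\mathbf{T}$ of a theory $\mathbf{T}$ by the underlying-set functor. *)

theory Defs
  imports Main
begin

section \<open>Lawvere theories, their morphisms, models and pushouts\<close>

text \<open>
  A Lawvere theory is a category whose objects are the natural numbers, in which the object \<open>n\<close>
  is the \<open>n\<close>-th power of the object \<open>1\<close>, with chosen projections. \<open>Hom T m n\<close> is the set of
  arrows from \<open>m\<close> to \<open>n\<close> (so \<open>Hom T m 1\<close> is the set of \<open>m\<close>-ary operations), and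
  \<open>Comp T k m n f g\<close> is the composite of \<open>g \<in> Hom T k m\<close> followed by \<open>f \<in> Hom T m n\<close>.
\<close>

record 'a law_theory =
  Hom :: "nat \<Rightarrow> nat \<Rightarrow> 'a set"
  Id :: "nat \<Rightarrow> 'a"
  Comp :: "nat \<Rightarrow> nat \<Rightarrow> nat \<Rightarrow> 'a \<Rightarrow> 'a \<Rightarrow> 'a"
  Proj :: "nat \<Rightarrow> nat \<Rightarrow> 'a"

definition lawvere_theory :: "'a law_theory \<Rightarrow> bool" where
  "lawvere_theory T \<longleftrightarrow>
     (\<forall>n. Id T n \<in> Hom T n n) \<and>
     (\<forall>k m n. \<forall>f\<in>Hom T m n. \<forall>g\<in>Hom T k m. Comp T k m n f g \<in> Hom T k n) \<and>
     (\<forall>m n. \<forall>f\<in>Hom T m n. Comp T m m n f (Id T m) = f \<and> Comp T m n n (Id T n) f = f) \<and>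
     (\<forall>j k m n. \<forall>f\<in>Hom T m n. \<forall>g\<in>Hom T k m. \<forall>h\<in>Hom T j k.
        Comp T j m n f (Comp T j k m g h) = Comp T j k n (Comp T k m n f g) h) \<and>
     (\<forall>n. \<forall>i<n. Proj T n i \<in> Hom T n 1) \<and>
     Proj T 1 0 = Id T 1 \<and>
     (\<forall>m n u. (\<forall>i<n. u i \<in> Hom T m 1) \<longrightarrow>
        (\<exists>!h. h \<in> Hom T m n \<and> (\<forall>i<n. Comp T m n 1 (Proj T n i) h = u i)))"

text \<open>
  Morphisms are the identity-on-objects functors that preserve the chosen projections. Only their
  values on arrows of the source matter, so they are compared by \<open>mor_eq\<close>.
\<close>

definition theory_morphism ::
  "'a law_theory \<Rightarrow> 'b law_theory \<Rightarrow> (nat \<Rightarrow> nat \<Rightarrow> 'a \<Rightarrow> 'b) \<Rightarrow> bool" where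
  "theory_morphism S T F \<longleftrightarrow>
     (\<forall>m n. \<forall>f\<in>Hom S m n. F m n f \<in> Hom T m n) \<and>
     (\<forall>n. F n n (Id S n) = Id T n) \<and>
     (\<forall>k m n. \<forall>f\<in>Hom S m n. \<forall>g\<in>Hom S k m.
        F k n (Comp S k m n f g) = Comp T k m n (F m n f) (F k m g)) \<and>
     (\<forall>n. \<forall>i<n. F n 1 (Proj S n i) = Proj T n i)"

definition mor_eq ::
  "'a law_theory \<Rightarrow> (nat \<Rightarrow> nat \<Rightarrow> 'a \<Rightarrow> 'b) \<Rightarrow> (nat \<Rightarrow> nat \<Rightarrow> 'a \<Rightarrow> 'b) \<Rightarrow> bool" where
  "mor_eq S F G \<longleftrightarrow> (\<forall>m n. \<forall>f\<in>Hom S m n. F m n f = G m n f)"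

definition mor_comp ::
  "(nat \<Rightarrow> nat \<Rightarrow> 'b \<Rightarrow> 'c) \<Rightarrow> (nat \<Rightarrow> nat \<Rightarrow> 'a \<Rightarrow> 'b) \<Rightarrow> nat \<Rightarrow> nat \<Rightarrow> 'a \<Rightarrow> 'c" where
  "mor_comp G F m n f = G m n (F m n f)"

text \<open>
  In \<open>pushout_square TYPE('x) A B C D top left right bottom\<close> the test theories have arrows in
  the type \<open>'x\<close>; a theorem that is polymorphic in \<open>'x\<close> covers all test theories.
\<close>

definition pushout_square ::
  "'x itself \<Rightarrow> 'a law_theory \<Rightarrow> 'b law_theory \<Rightarrow> 'c law_theory \<Rightarrow> 'd law_theory \<Rightarrow>
   (nat \<Rightarrow> nat \<Rightarrow> 'a \<Rightarrow> 'b) \<Rightarrow> (nat \<Rightarrow> nat \<Rightarrow> 'a \<Rightarrow> 'c) \<Rightarrow>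
   (nat \<Rightarrow> nat \<Rightarrow> 'b \<Rightarrow> 'd) \<Rightarrow> (nat \<Rightarrow> nat \<Rightarrow> 'c \<Rightarrow> 'd) \<Rightarrow> bool" where
  "pushout_square _ A B C D t l r b \<longleftrightarrow>
     lawvere_theory A \<and> lawvere_theory B \<and> lawvere_theory C \<and> lawvere_theory D \<and>
     theory_morphism A B t \<and> theory_morphism A C l \<and>
     theory_morphism B D r \<and> theory_morphism C D b \<and>
     mor_eq A (mor_comp r t) (mor_comp b l) \<and>
     (\<forall>(X :: 'x law_theory) p q.
        lawvere_theory X \<and> theory_morphism B X p \<and> theory_morphism C X q \<and>
        mor_eq A (mor_comp p t) (mor_comp q l) \<longrightarrow>
        (\<exists>u. theory_morphism D X u \<and>
             mor_eq B (mor_comp u r) p \<and> mor_eq C (mor_comp u b) q \<and>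
             (\<forall>v. theory_morphism D X v \<and>
                  mor_eq B (mor_comp v r) p \<and> mor_eq C (mor_comp v b) q \<longrightarrow> mor_eq D v u)))"

text \<open>
  A model of \<open>T\<close> on the set \<open>A\<close> is a product-preserving functor to sets that sends \<open>1\<close> to \<open>A\<close>;
  the power \<open>A\<^sup>n\<close> consists of the lists of length \<open>n\<close>. The right adjoint of a morphism
  \<open>F\<close> of theories sends a model \<open>M\<close> to \<open>\<lambda>m n f. M m n (F m n f)\<close>.
\<close>

definition pows :: "'c set \<Rightarrow> nat \<Rightarrow> 'c list set" where
  "pows A n = {xs. length xs = n \<and> set xs \<subseteq> A}"

definition model ::
  "'a law_theory \<Rightarrow> 'c set \<Rightarrow> (nat \<Rightarrow> nat \<Rightarrow> 'a \<Rightarrow> 'c list \<Rightarrow> 'c list) \<Rightarrow> bool" where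
  "model T A M \<longleftrightarrow>
     (\<forall>m n. \<forall>f\<in>Hom T m n. \<forall>xs\<in>pows A m. M m n f xs \<in> pows A n) \<and>
     (\<forall>n. \<forall>xs\<in>pows A n. M n n (Id T n) xs = xs) \<and>
     (\<forall>k m n. \<forall>f\<in>Hom T m n. \<forall>g\<in>Hom T k m. \<forall>xs\<in>pows A k.
        M k n (Comp T k m n f g) xs = M m n f (M k m g xs)) \<and>
     (\<forall>n. \<forall>i<n. \<forall>xs\<in>pows A n. M n 1 (Proj T n i) xs = [xs ! i])"

definition model_eq ::
  "'a law_theory \<Rightarrow> 'c set \<Rightarrow> (nat \<Rightarrow> nat \<Rightarrow> 'a \<Rightarrow> 'c list \<Rightarrow> 'c list) \<Rightarrow>
   (nat \<Rightarrow> nat \<Rightarrow> 'a \<Rightarrow> 'c list \<Rightarrow> 'c list) \<Rightarrow> bool" where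
  "model_eq T A M N \<longleftrightarrow> (\<forall>m n. \<forall>f\<in>Hom T m n. \<forall>xs\<in>pows A m. M m n f xs = N m n f xs)"

definition model_hom ::
  "'a law_theory \<Rightarrow> 'c set \<Rightarrow> (nat \<Rightarrow> nat \<Rightarrow> 'a \<Rightarrow> 'c list \<Rightarrow> 'c list) \<Rightarrow>
   'd set \<Rightarrow> (nat \<Rightarrow> nat \<Rightarrow> 'a \<Rightarrow> 'd list \<Rightarrow> 'd list) \<Rightarrow> ('c \<Rightarrow> 'd) \<Rightarrow> bool" where
  "model_hom T A M B N h \<longleftrightarrow> h ` A \<subseteq> B \<and>
     (\<forall>m n. \<forall>f\<in>Hom T m n. \<forall>xs\<in>pows A m. map h (M m n f xs) = N m n f (map h xs))"

section \<open>The Lawvere theory of a set of binary operations and equations\<close>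

datatype 'f trm = Var nat | App 'f "'f trm" "'f trm"

primrec subst :: "(nat \<Rightarrow> 'f trm) \<Rightarrow> 'f trm \<Rightarrow> 'f trm" where
  "subst \<sigma> (Var i) = \<sigma> i"
| "subst \<sigma> (App f s t) = App f (subst \<sigma> s) (subst \<sigma> t)"

inductive_set trms :: "'f set \<Rightarrow> nat \<Rightarrow> 'f trm set" for F :: "'f set" and m :: nat where
  Var: "i < m \<Longrightarrow> Var i \<in> trms F m"
| App: "f \<in> F \<Longrightarrow> s \<in> trms F m \<Longrightarrow> t \<in> trms F m \<Longrightarrow> App f s t \<in> trms F m"

text \<open>
  \<open>eqv F E m\<close> is provable equality from \<open>E\<close> of terms in the variables \<open>0, \<dots>, m - 1\<close>, that is,
  the congruence on \<open>trms F m\<close> generated by all substitution instances of \<open>E\<close>. The quotient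
  \<open>cls F E m ` trms F m\<close> is the free algebra on \<open>m\<close> generators.
\<close>

inductive eqv :: "'f set \<Rightarrow> ('f trm \<times> 'f trm) set \<Rightarrow> nat \<Rightarrow> 'f trm \<Rightarrow> 'f trm \<Rightarrow> bool"
  for F :: "'f set" and E :: "('f trm \<times> 'f trm) set" and m :: nat where
  ax: "(l, r) \<in> E \<Longrightarrow> (\<And>i. \<sigma> i \<in> trms F m) \<Longrightarrow> eqv F E m (subst \<sigma> l) (subst \<sigma> r)"
| refl: "t \<in> trms F m \<Longrightarrow> eqv F E m t t"
| sym: "eqv F E m s t \<Longrightarrow> eqv F E m t s"
| trans: "eqv F E m s t \<Longrightarrow> eqv F E m t u \<Longrightarrow> eqv F E m s u"
| cong: "f \<in> F \<Longrightarrow> eqv F E m s s' \<Longrightarrow> eqv F E m t t' \<Longrightarrow> eqv F E m (App f s t) (App f s' t')"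

definition cls :: "'f set \<Rightarrow> ('f trm \<times> 'f trm) set \<Rightarrow> nat \<Rightarrow> 'f trm \<Rightarrow> 'f trm set" where
  "cls F E m t = {u. eqv F E m t u}"

definition rep :: "'f trm set \<Rightarrow> 'f trm" where
  "rep c = (SOME t. t \<in> c)"

definition Th :: "'f set \<Rightarrow> ('f trm \<times> 'f trm) set \<Rightarrow> 'f trm set list law_theory" where
  "Th F E =
     \<lparr>Hom = (\<lambda>m n. {cs. length cs = n \<and> set cs \<subseteq> cls F E m ` trms F m}),
      Id = (\<lambda>n. map (\<lambda>i. cls F E n (Var i)) [0..<n]),
      Comp = (\<lambda>k m n f g. map (\<lambda>c. cls F E k (subst (\<lambda>i. rep (g ! i)) (rep c))) f),
      Proj = (\<lambda>n i. [cls F E n (Var i)])\<rparr>"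

text \<open>
  An interpretation assigns to each operation symbol a binary operation of the target theory, given
  by a term in \<open>Var 0\<close> and \<open>Var 1\<close>. If the equations of the source hold in the target, it
  induces the morphism \<open>interp_mor F' E' \<sigma>\<close> into \<open>Th F' E'\<close>.
\<close>

primrec translate :: "('f \<Rightarrow> 'g trm) \<Rightarrow> 'f trm \<Rightarrow> 'g trm" where
  "translate \<sigma> (Var i) = Var i"
| "translate \<sigma> (App f s t) =
     subst (\<lambda>i. if i = 0 then translate \<sigma> s else translate \<sigma> t) (\<sigma> f)"

definition interp_mor ::
  "'g set \<Rightarrow> ('g trm \<times> 'g trm) set \<Rightarrow> ('f \<Rightarrow> 'g trm) \<Rightarrow>
   nat \<Rightarrow> nat \<Rightarrow> 'f trm set list \<Rightarrow> 'g trm set list" where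
  "interp_mor F' E' \<sigma> m n cs = map (\<lambda>c. cls F' E' m (translate \<sigma> (rep c))) cs"

section \<open>The theories of sets, racks, quandles, involutary racks and kei\<close>

definition rack :: "'c set \<Rightarrow> ('c \<Rightarrow> 'c \<Rightarrow> 'c) \<Rightarrow> bool" where
  "rack R b \<longleftrightarrow> (\<forall>x\<in>R. bij_betw (b x) R R) \<and>
     (\<forall>x\<in>R. \<forall>y\<in>R. \<forall>z\<in>R. b x (b y z) = b (b x y) (b x z))"

definition quandle :: "'c set \<Rightarrow> ('c \<Rightarrow> 'c \<Rightarrow> 'c) \<Rightarrow> bool" where
  "quandle R b \<longleftrightarrow> rack R b \<and> (\<forall>x\<in>R. b x x = x)"

definition involutary_rack :: "'c set \<Rightarrow> ('c \<Rightarrow> 'c \<Rightarrow> 'c) \<Rightarrow> bool" where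
  "involutary_rack R b \<longleftrightarrow> rack R b \<and> (\<forall>x\<in>R. \<forall>y\<in>R. b x (b x y) = y)"

definition kei :: "'c set \<Rightarrow> ('c \<Rightarrow> 'c \<Rightarrow> 'c) \<Rightarrow> bool" where
  "kei R b \<longleftrightarrow> quandle R b \<and> (\<forall>x\<in>R. \<forall>y\<in>R. b x (b x y) = y)"

text \<open>
  Bijectivity of the left multiplications is expressed by equations with a second operation
  \<open>ActInv\<close>, where \<open>y \<mapsto> ActInv x y\<close> is the inverse of \<open>y \<mapsto> Act x y\<close>.
\<close>

datatype rack_sym = Act | ActInv

abbreviation X0 :: "rack_sym trm" where "X0 \<equiv> Var 0"
abbreviation X1 :: "rack_sym trm" where "X1 \<equiv> Var 1"
abbreviation X2 :: "rack_sym trm" where "X2 \<equiv> Var 2"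

definition rack_eqns :: "(rack_sym trm \<times> rack_sym trm) set" where
  "rack_eqns =
     {(App Act X0 (App ActInv X0 X1), X1),
      (App ActInv X0 (App Act X0 X1), X1),
      (App Act X0 (App Act X1 X2), App Act (App Act X0 X1) (App Act X0 X2))}"

definition idem_eqn :: "rack_sym trm \<times> rack_sym trm" where
  "idem_eqn = (App Act X0 X0, X0)"

definition invol_eqn :: "rack_sym trm \<times> rack_sym trm" where
  "invol_eqn = (App Act X0 (App Act X0 X1), X1)"

definition quandle_eqns :: "(rack_sym trm \<times> rack_sym trm) set" where
  "quandle_eqns = insert idem_eqn rack_eqns"

definition invo_eqns :: "(rack_sym trm \<times> rack_sym trm) set" where
  "invo_eqns = insert invol_eqn rack_eqns"

definition kei_eqns :: "(rack_sym trm \<times> rack_sym trm) set" where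
  "kei_eqns = insert invol_eqn quandle_eqns"

definition Sets_th :: "rack_sym trm set list law_theory" where
  "Sets_th = Th {} {}"

definition Rack_th :: "rack_sym trm set list law_theory" where
  "Rack_th = Th UNIV rack_eqns"

definition Quan_th :: "rack_sym trm set list law_theory" where
  "Quan_th = Th UNIV quandle_eqns"

definition Invo_th :: "rack_sym trm set list law_theory" where
  "Invo_th = Th UNIV invo_eqns"

definition Kei_th :: "rack_sym trm set list law_theory" where
  "Kei_th = Th UNIV kei_eqns"

type_synonym rack_mor =
  "nat \<Rightarrow> nat \<Rightarrow> rack_sym trm set list \<Rightarrow> rack_sym trm set list"

definition Psi2_interp :: "rack_sym \<Rightarrow> rack_sym trm" where
  "Psi2_interp f = App f X0 (App f X0 X1)"

definition trivial_interp :: "rack_sym \<Rightarrow> rack_sym trm" where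
  "trivial_interp f = X1"

definition same_interp :: "rack_sym \<Rightarrow> rack_sym trm" where
  "same_interp f = App f X0 X1"

definition Psi2_Rack :: rack_mor where
  "Psi2_Rack = interp_mor UNIV rack_eqns Psi2_interp"

definition Psi2_Quan :: rack_mor where
  "Psi2_Quan = interp_mor UNIV quandle_eqns Psi2_interp"

text \<open>
  \<open>triv_mor\<close> is the morphism \<open>id\<close> from racks or quandles to sets; its right adjoint equips a set
  with the trivial structure.
\<close>

definition triv_mor :: rack_mor where
  "triv_mor = interp_mor {} {} trivial_interp"

text \<open>
  Into \<open>Invo_th\<close> and \<open>Kei_th\<close>, both the morphism \<open>\<supset>\<close> and the structure morphism from
  \<open>Sets_th\<close> send the class of a term to the class of the same term.
\<close>

definition incl_Invo :: rack_mor where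
  "incl_Invo = interp_mor UNIV invo_eqns same_interp"

definition incl_Kei :: rack_mor where
  "incl_Kei = interp_mor UNIV kei_eqns same_interp"

definition struct_Invo :: rack_mor where
  "struct_Invo = interp_mor UNIV invo_eqns same_interp"

definition struct_Kei :: rack_mor where
  "struct_Kei = interp_mor UNIV kei_eqns same_interp"

section \<open>Models of the theories and right adjoints of the morphisms\<close>

primrec ev :: "('f \<Rightarrow> 'c \<Rightarrow> 'c \<Rightarrow> 'c) \<Rightarrow> (nat \<Rightarrow> 'c) \<Rightarrow> 'f trm \<Rightarrow> 'c" where
  "ev I v (Var i) = v i"
| "ev I v (App f s t) = I f (ev I v s) (ev I v t)"

definition satisfies ::
  "'c set \<Rightarrow> 'f set \<Rightarrow> ('f trm \<times> 'f trm) set \<Rightarrow> ('f \<Rightarrow> 'c \<Rightarrow> 'c \<Rightarrow> 'c) \<Rightarrow> bool" where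
  "satisfies A F E I \<longleftrightarrow> (\<forall>f\<in>F. \<forall>x\<in>A. \<forall>y\<in>A. I f x y \<in> A) \<and>
     (\<forall>(l, r)\<in>E. \<forall>v. (\<forall>i. v i \<in> A) \<longrightarrow> ev I v l = ev I v r)"

definition action ::
  "('f \<Rightarrow> 'c \<Rightarrow> 'c \<Rightarrow> 'c) \<Rightarrow> nat \<Rightarrow> nat \<Rightarrow> 'f trm set list \<Rightarrow> 'c list \<Rightarrow> 'c list" where
  "action I m n cs xs = map (\<lambda>c. ev I (\<lambda>i. xs ! i) (rep c)) cs"

definition wf_eqns :: "'f set \<Rightarrow> ('f trm \<times> 'f trm) set \<Rightarrow> bool" where
  "wf_eqns F E \<longleftrightarrow> (\<forall>(l, r)\<in>E. \<exists>n. l \<in> trms F n \<and> r \<in> trms F n)"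

lemma trms_iff [simp]:
  "Var i \<in> trms F m \<longleftrightarrow> i < m"
  "App f s t \<in> trms F m \<longleftrightarrow> f \<in> F \<and> s \<in> trms F m \<and> t \<in> trms F m"
  by (auto intro: trms.intros elim: trms.cases)

lemma subst_trms: "t \<in> trms F n \<Longrightarrow> (\<And>i. i < n \<Longrightarrow> \<sigma> i \<in> trms F m) \<Longrightarrow> subst \<sigma> t \<in> trms F m"
  by (induction rule: trms.induct) (auto intro: trms.intros)

lemma eqv_trms:
  assumes "wf_eqns F E" "eqv F E m s t"
  shows "s \<in> trms F m \<and> t \<in> trms F m"
  using assms(2)
proof (induction rule: eqv.induct)
  case (ax l r \<sigma>)
  then show ?case using assms(1) unfolding wf_eqns_def by (fast intro: subst_trms)
qed (auto intro: trms.intros)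

lemma subst_subst: "subst \<sigma> (subst \<tau> t) = subst (\<lambda>i. subst \<sigma> (\<tau> i)) t"
  by (induction t) auto

lemma ev_subst: "ev I v (subst \<sigma> t) = ev I (\<lambda>i. ev I v (\<sigma> i)) t"
  by (induction t) auto

lemma ev_in: "t \<in> trms F m \<Longrightarrow> satisfies A F E I \<Longrightarrow> (\<And>i. i < m \<Longrightarrow> v i \<in> A) \<Longrightarrow> ev I v t \<in> A"
  by (induction rule: trms.induct) (auto simp: satisfies_def)

lemma ev_cong: "t \<in> trms F m \<Longrightarrow> (\<And>i. i < m \<Longrightarrow> v i = w i) \<Longrightarrow> ev I v t = ev I w t"
  by (induction rule: trms.induct) auto

lemma subst_cong: "t \<in> trms F m \<Longrightarrow> (\<And>i. i < m \<Longrightarrow> \<sigma> i = \<tau> i) \<Longrightarrow> subst \<sigma> t = subst \<tau> t"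
  by (induction rule: trms.induct) auto

lemma eqv_sound:
  assumes "eqv F E m s t" "satisfies A F E I" "\<And>i. i < m \<Longrightarrow> v i \<in> A"
  shows "ev I v s = ev I v t"
  using assms(1)
proof (induction rule: eqv.induct)
  case (ax l r \<sigma>)
  have "ev I v (\<sigma> i) \<in> A" for i using ax ev_in assms by metis
  then show ?case using ax assms(2) by (auto simp: satisfies_def ev_subst)
qed auto

lemma eqv_subst:
  assumes "wf_eqns F E" "eqv F E m s t" "\<And>i. i < m \<Longrightarrow> eqv F E k (\<sigma> i) (\<tau> i)"
  shows "eqv F E k (subst \<sigma> s) (subst \<tau> t)"
proof -
  have tr: "\<And>i. i < m \<Longrightarrow> \<sigma> i \<in> trms F k" using assms eqv_trms by blast
  have "eqv F E k (subst \<sigma> s) (subst \<sigma> t)" using assms(2)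
  proof (induction rule: eqv.induct)
    case (ax l r \<rho>)
    have "eqv F E k (subst (\<lambda>i. subst \<sigma> (\<rho> i)) l) (subst (\<lambda>i. subst \<sigma> (\<rho> i)) r)"
      using ax tr by (intro eqv.ax) (auto intro: subst_trms)
    then show ?case by (simp add: subst_subst)
  next
    case (refl t) then show ?case using tr by (auto intro: eqv.refl subst_trms)
  next
    case (sym s t) then show ?case by (blast intro: eqv.sym)
  next
    case (trans s t u) then show ?case by (blast intro: eqv.trans)
  next
    case (cong f s s' t t') then show ?case by (auto intro: eqv.cong)
  qed
  moreover have "t \<in> trms F m" using assms eqv_trms by blast
  then have "eqv F E k (subst \<sigma> t) (subst \<tau> t)"
    by (induction rule: trms.induct) (auto intro: eqv.cong assms(3))
  ultimately show ?thesis by (rule eqv.trans)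
qed

lemma cls_eq: "eqv F E m s t \<Longrightarrow> cls F E m s = cls F E m t"
  unfolding cls_def by (blast intro: eqv.sym eqv.trans)

lemma rep_cls: "t \<in> trms F m \<Longrightarrow> eqv F E m t (rep (cls F E m t))"
  unfolding rep_def cls_def by (rule someI2[of _ t]) (auto intro: eqv.refl)

lemma Hom_Th: "cs \<in> Hom (Th F E) m n \<longleftrightarrow>
    (\<exists>ts. length ts = n \<and> set ts \<subseteq> trms F m \<and> cs = map (cls F E m) ts)"
proof
  assume "cs \<in> Hom (Th F E) m n"
  then have h: "length cs = n" "set cs \<subseteq> cls F E m ` trms F m" by (auto simp: Th_def)
  from h(2) have "\<forall>c\<in>set cs. \<exists>t. t \<in> trms F m \<and> c = cls F E m t" by auto
  then obtain t where "\<forall>c\<in>set cs. t c \<in> trms F m \<and> c = cls F E m (t c)" by metis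
  then show "\<exists>ts. length ts = n \<and> set ts \<subseteq> trms F m \<and> cs = map (cls F E m) ts"
    using h(1) by (intro exI[of _ "map t cs"]) (auto intro!: nth_equalityI)
next
  assume "\<exists>ts. length ts = n \<and> set ts \<subseteq> trms F m \<and> cs = map (cls F E m) ts"
  then obtain ts where "length ts = n" "set ts \<subseteq> trms F m" "cs = map (cls F E m) ts" by blast
  then show "cs \<in> Hom (Th F E) m n" using image_mono[of "set ts" "trms F m" "cls F E m"]
    by (simp add: Th_def)
qed

lemma Comp_Th:
  assumes "wf_eqns F E" "set ts \<subseteq> trms F m" "length us = m" "set us \<subseteq> trms F k"
  shows "Comp (Th F E) k m n (map (cls F E m) ts) (map (cls F E k) us) =
    map (\<lambda>t. cls F E k (subst (\<lambda>i. us ! i) t)) ts"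
proof -
  have "cls F E k (subst (\<lambda>i. rep (map (cls F E k) us ! i)) (rep (cls F E m t)))
      = cls F E k (subst (\<lambda>i. us ! i) t)" if "t \<in> set ts" for t
    using assms that
    by (intro cls_eq eqv_subst[OF assms(1), of m]) (auto intro!: eqv.sym[OF rep_cls])
  then show ?thesis by (simp add: Th_def)
qed

lemma action_cls:
  assumes "satisfies A F E I" "set ts \<subseteq> trms F m" "xs \<in> pows A m"
  shows "action I m n (map (cls F E m) ts) xs = map (ev I (\<lambda>i. xs ! i)) ts"
proof -
  have "ev I (\<lambda>i. xs ! i) (rep (cls F E m t)) = ev I (\<lambda>i. xs ! i) t" if "t \<in> set ts" for t
    using assms that by (intro eqv_sound[OF eqv.sym[OF rep_cls] assms(1)]) (auto simp: pows_def)
  then show ?thesis by (simp add: action_def)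
qed

lemma model_action:
  assumes "wf_eqns F E" "satisfies A F E I"
  shows "model (Th F E) A (action I)"
  unfolding model_def
proof (intro conjI allI ballI impI)
  fix m n f xs assume "f \<in> Hom (Th F E) m n" and xs: "xs \<in> pows A m"
  then obtain ts where ts: "length ts = n" "set ts \<subseteq> trms F m" "f = map (cls F E m) ts"
    by (auto simp: Hom_Th)
  have "ev I (\<lambda>i. xs ! i) t \<in> A" if "t \<in> set ts" for t
    using that ts xs by (intro ev_in[OF _ assms(2)]) (auto simp: pows_def)
  then show "action I m n f xs \<in> pows A n"
    using ts action_cls[OF assms(2) ts(2) xs] by (auto simp: pows_def)
next
  fix n xs assume xs: "xs \<in> pows A n"
  have "action I n n (map (cls F E n) (map Var [0..<n])) xs = map (ev I (\<lambda>i. xs ! i)) (map Var [0..<n])"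
    by (rule action_cls[OF assms(2) _ xs]) (auto intro: trms.intros)
  also have "\<dots> = xs" using xs by (auto simp: pows_def comp_def map_nth)
  finally show "action I n n (Id (Th F E) n) xs = xs" by (simp add: Th_def comp_def)
next
  fix k m n f g xs
  assume "f \<in> Hom (Th F E) m n" "g \<in> Hom (Th F E) k m" and xs: "xs \<in> pows A k"
  then obtain ts us where ts: "length ts = n" "set ts \<subseteq> trms F m" "f = map (cls F E m) ts"
    and us: "length us = m" "set us \<subseteq> trms F k" "g = map (cls F E k) us"
    by (auto simp: Hom_Th)
  have tr: "set (map (subst (\<lambda>i. us ! i)) ts) \<subseteq> trms F k"
    using ts us by (auto intro!: subst_trms)
  have ys: "map (ev I (\<lambda>i. xs ! i)) us \<in> pows A m"
    using us xs by (auto simp: pows_def intro!: ev_in[OF _ assms(2), of _ k])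
  have "Comp (Th F E) k m n f g = map (cls F E k) (map (subst (\<lambda>i. us ! i)) ts)"
    using Comp_Th[OF assms(1) ts(2) us(1,2)] ts us by (simp add: comp_def)
  then have "action I k n (Comp (Th F E) k m n f g) xs =
      map (\<lambda>t. ev I (\<lambda>i. ev I (\<lambda>i. xs ! i) (us ! i)) t) ts"
    using action_cls[OF assms(2) tr xs] by (simp add: comp_def ev_subst)
  also have "\<dots> = map (\<lambda>t. ev I (\<lambda>i. map (ev I (\<lambda>i. xs ! i)) us ! i) t) ts"
    using ts us by (auto intro!: ev_cong[of _ F m])
  also have "\<dots> = action I m n f (action I k m g xs)"
    using action_cls[OF assms(2) us(2) xs] action_cls[OF assms(2) ts(2) ys] ts us by simp
  finally show "action I k n (Comp (Th F E) k m n f g) xs = action I m n f (action I k m g xs)" .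
next
  fix n i xs assume "i < (n::nat)" and xs: "xs \<in> pows A n"
  then show "action I n 1 (Proj (Th F E) n i) xs = [xs ! i]"
    using action_cls[OF assms(2) _ xs, of "[Var i]"] by (auto simp: Th_def intro: trms.intros)
qed

lemma model_is_action:
  assumes wf: "wf_eqns F E" and M: "model (Th F E) A M"
  obtains I where "satisfies A F E I" "model_eq (Th F E) A M (action I)"
proof -
  let ?T = "Th F E"
  define I where "I = (\<lambda>f x y. hd (M 2 1 [cls F E 2 (App f (Var 0) (Var 1))] [x, y]))"
  have M1: "\<And>m n f xs. f \<in> Hom ?T m n \<Longrightarrow> xs \<in> pows A m \<Longrightarrow> M m n f xs \<in> pows A n"
    and Mc: "\<And>k m n f g xs. f \<in> Hom ?T m n \<Longrightarrow> g \<in> Hom ?T k m \<Longrightarrow> xs \<in> pows A k \<Longrightarrow>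
        M k n (Comp ?T k m n f g) xs = M m n f (M k m g xs)"
    and Mp: "\<And>n i xs. i < n \<Longrightarrow> xs \<in> pows A n \<Longrightarrow> M n 1 (Proj ?T n i) xs = [xs ! i]"
    using M unfolding model_def by auto
  have tup: "M m n (map (cls F E m) ts) xs = map (\<lambda>t. hd (M m 1 [cls F E m t] xs)) ts"
    if ts: "length ts = n" "set ts \<subseteq> trms F m" and xs: "xs \<in> pows A m" for m n ts xs
  proof (rule nth_equalityI)
    have H: "map (cls F E m) ts \<in> Hom ?T m n" using ts by (auto simp: Hom_Th)
    have in_n: "M m n (map (cls F E m) ts) xs \<in> pows A n" by (rule M1[OF H xs])
    then show "length (M m n (map (cls F E m) ts) xs) = length (map (\<lambda>t. hd (M m 1 [cls F E m t] xs)) ts)"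
      using ts by (simp add: pows_def)
    fix i assume "i < length (M m n (map (cls F E m) ts) xs)"
    then have i: "i < n" using in_n by (simp add: pows_def)
    have P: "Proj ?T n i = map (cls F E n) [Var i]" by (simp add: Th_def)
    have PH: "Proj ?T n i \<in> Hom ?T n 1" unfolding P Hom_Th
      using i by (intro exI[of _ "[Var i]"]) (auto intro: trms.intros)
    have "Comp ?T m n 1 (Proj ?T n i) (map (cls F E m) ts) = [cls F E m (ts ! i)]"
      unfolding P using Comp_Th[OF wf _ ts, of "[Var i]" 1] i by (auto intro: trms.intros)
    then have "M m 1 [cls F E m (ts ! i)] xs = [M m n (map (cls F E m) ts) xs ! i]"
      using Mc[OF PH H xs] Mp[OF i in_n] by simp
    then show "M m n (map (cls F E m) ts) xs ! i = map (\<lambda>t. hd (M m 1 [cls F E m t] xs)) ts ! i"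
      using i ts by simp
  qed
  have one: "M m 1 [cls F E m t] xs = [ev I (\<lambda>i. xs ! i) t]"
    if "t \<in> trms F m" and xs: "xs \<in> pows A m" for m t xs
    using that(1)
  proof (induction rule: trms.induct)
    case (Var i)
    then show ?case using Mp[OF Var xs] by (simp add: Th_def)
  next
    case (App f s t)
    let ?x = "App f (Var 0) (Var 1)"
    have x: "?x \<in> trms F 2" using App by (auto intro: trms.intros)
    have xH: "[cls F E 2 ?x] \<in> Hom ?T 2 1" using x by (auto simp: Hom_Th intro!: exI[of _ "[?x]"])
    have stH: "[cls F E m s, cls F E m t] \<in> Hom ?T m 2"
      using App by (auto simp: Hom_Th intro!: exI[of _ "[s, t]"])
    have "Comp ?T m 2 1 [cls F E 2 ?x] [cls F E m s, cls F E m t] = [cls F E m (App f s t)]"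
      using Comp_Th[OF wf, of "[?x]" 2 "[s, t]" m 1] x App by simp
    then have "M m 1 [cls F E m (App f s t)] xs =
        M 2 1 [cls F E 2 ?x] (M m 2 [cls F E m s, cls F E m t] xs)"
      using Mc[OF xH stH xs] by simp
    also have "M m 2 [cls F E m s, cls F E m t] xs = [ev I (\<lambda>i. xs ! i) s, ev I (\<lambda>i. xs ! i) t]"
      using tup[of "[s, t]" 2 m xs] App xs by simp
    finally have e: "M m 1 [cls F E m (App f s t)] xs =
        M 2 1 [cls F E 2 ?x] [ev I (\<lambda>i. xs ! i) s, ev I (\<lambda>i. xs ! i) t]" .
    have "[cls F E m (App f s t)] \<in> Hom ?T m 1"
      using App by (auto simp: Hom_Th intro!: exI[of _ "[App f s t]"] trms.intros)
    from M1[OF this xs] have "length (M m 1 [cls F E m (App f s t)] xs) = 1"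
      by (simp add: pows_def)
    then show ?case unfolding e by (auto simp: I_def length_Suc_conv)
  qed
  have "satisfies A F E I"
    unfolding satisfies_def
  proof (intro conjI ballI)
    fix f x y assume f: "f \<in> F" and xy: "x \<in> A" "y \<in> A"
    let ?x = "App f (Var 0) (Var 1)"
    have x: "?x \<in> trms F 2" using f by (auto intro: trms.intros)
    have xH: "[cls F E 2 ?x] \<in> Hom ?T 2 1" using x by (auto simp: Hom_Th intro!: exI[of _ "[?x]"])
    have p: "[x, y] \<in> pows A 2" using xy by (simp add: pows_def)
    show "I f x y \<in> A" using M1[OF xH p] one[OF x p] by (simp add: pows_def)
  next
    fix e assume e: "e \<in> E"
    obtain l r where lr: "e = (l, r)" by force
    obtain n where n: "l \<in> trms F n" "r \<in> trms F n" using wf e lr by (auto simp: wf_eqns_def)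
    have mono: "t \<in> trms F (Suc n)" if "t \<in> trms F n" for t
      using that by (induction rule: trms.induct) (auto intro: trms.intros)
    have "ev I v l = ev I v r" if v: "\<forall>i. v i \<in> A" for v
    proof -
      let ?xs = "map v [0..<Suc n]"
      define \<sigma> where "\<sigma> = (\<lambda>i. if i < Suc n then Var i else (Var 0 :: 'a trm))"
      have p: "?xs \<in> pows A (Suc n)" using v by (auto simp: pows_def)
      have "eqv F E (Suc n) (subst \<sigma> l) (subst \<sigma> r)"
        using e lr by (intro eqv.ax) (auto simp: \<sigma>_def intro: trms.intros)
      moreover have "subst \<sigma> t = t" if "t \<in> trms F (Suc n)" for t
        using that by (induction rule: trms.induct) (auto simp: \<sigma>_def)
      ultimately have "cls F E (Suc n) l = cls F E (Suc n) r"
        using n mono by (intro cls_eq) auto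
      then have "ev I (\<lambda>i. ?xs ! i) l = ev I (\<lambda>i. ?xs ! i) r"
        using one[OF mono[OF n(1)] p] one[OF mono[OF n(2)] p] by simp
      moreover have "ev I (\<lambda>i. ?xs ! i) t = ev I v t" if "t \<in> trms F n" for t
        using that by (rule ev_cong) (simp del: upt_Suc)
      ultimately show ?thesis using n by simp
    qed
    then show "case e of (l, r) \<Rightarrow> \<forall>v. (\<forall>i. v i \<in> A) \<longrightarrow> ev I v l = ev I v r"
      using lr by simp
  qed
  moreover have "model_eq ?T A M (action I)"
    unfolding model_eq_def
  proof (intro allI ballI)
    fix m n f xs assume "f \<in> Hom ?T m n" and xs: "xs \<in> pows A m"
    then obtain ts where ts: "length ts = n" "set ts \<subseteq> trms F m" "f = map (cls F E m) ts"
      by (auto simp: Hom_Th)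
    then show "M m n f xs = action I m n f xs"
      using tup[OF ts(1,2) xs] action_cls[OF calculation ts(2) xs] one[OF _ xs]
      by auto
  qed
  ultimately show thesis by (rule that)
qed

lemma translate_trms:
  assumes "\<And>f. f \<in> F \<Longrightarrow> \<sigma> f \<in> trms F' 2"
  shows "t \<in> trms F m \<Longrightarrow> translate \<sigma> t \<in> trms F' m"
  by (induction rule: trms.induct) (auto intro!: trms.intros subst_trms[OF assms])

lemma ev_translate:
  "ev I v (translate \<sigma> t) = ev (\<lambda>f x y. ev I (\<lambda>i. if i = 0 then x else y) (\<sigma> f)) v t"
  by (induction t) (auto simp: ev_subst if_distrib[of "ev I v"] cong: if_cong)

lemma action_interp:
  assumes "wf_eqns F E" "\<And>f. f \<in> F \<Longrightarrow> \<sigma> f \<in> trms F' 2" "satisfies A F' E' I"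
    "cs \<in> Hom (Th F E) m n" "xs \<in> pows A m"
  shows "action I m n (interp_mor F' E' \<sigma> m n cs) xs =
    action (\<lambda>f x y. ev I (\<lambda>i. if i = 0 then x else y) (\<sigma> f)) m n cs xs"
proof -
  have cs: "rep c \<in> trms F m" if c: "c \<in> set cs" for c
  proof -
    from c assms(4) obtain t where "t \<in> trms F m" "c = cls F E m t" by (auto simp: Th_def)
    then show ?thesis using rep_cls eqv_trms[OF assms(1)] by metis
  qed
  have tr: "set (map (\<lambda>c. translate \<sigma> (rep c)) cs) \<subseteq> trms F' m"
    using translate_trms[where F = F and \<sigma> = \<sigma> and F' = F', OF assms(2)] cs by auto
  have "interp_mor F' E' \<sigma> m n cs = map (cls F' E' m) (map (\<lambda>c. translate \<sigma> (rep c)) cs)"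
    by (simp add: interp_mor_def)
  then show ?thesis
    using action_cls[OF assms(3) tr assms(5)] by (simp add: action_def ev_translate)
qed

lemma satisfies_closed: "satisfies A F E I \<Longrightarrow> satisfies A F {} I"
  by (simp add: satisfies_def)

lemma action_agree:
  assumes "wf_eqns F E" "satisfies A F {} I"
    "\<And>f x y. f \<in> F \<Longrightarrow> x \<in> A \<Longrightarrow> y \<in> A \<Longrightarrow> I f x y = J f x y"
    "cs \<in> Hom (Th F E) m n" "xs \<in> pows A m"
  shows "action I m n cs xs = action J m n cs xs"
proof -
  have xs: "xs ! i \<in> A" if "i < m" for i using assms(5) that by (auto simp: pows_def)
  have "ev I (\<lambda>i. xs ! i) (rep c) = ev J (\<lambda>i. xs ! i) (rep c)" if c: "c \<in> set cs" for c
  proof -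
    from c assms(4) obtain t where "t \<in> trms F m" "c = cls F E m t" by (auto simp: Th_def)
    then have "rep c \<in> trms F m" using rep_cls eqv_trms[OF assms(1)] by metis
    then show ?thesis
    proof (induction rule: trms.induct)
      case (App f s t)
      have "ev I (\<lambda>i. xs ! i) s \<in> A" "ev I (\<lambda>i. xs ! i) t \<in> A"
        using ev_in[OF App.hyps(2) assms(2) xs] ev_in[OF App.hyps(3) assms(2) xs] by simp_all
      then show ?case using App assms(3)[OF App(1)] by simp
    qed simp
  qed
  then show ?thesis by (simp add: action_def)
qed

text \<open>The model of the theories on a rack, and the model of \<open>Sets_th\<close> on a set.\<close>

definition rack_ops :: "'c set \<Rightarrow> ('c \<Rightarrow> 'c \<Rightarrow> 'c) \<Rightarrow> rack_sym \<Rightarrow> 'c \<Rightarrow> 'c \<Rightarrow> 'c" where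
  "rack_ops R b f = (case f of Act \<Rightarrow> b | ActInv \<Rightarrow> (\<lambda>x y. inv_into R (b x) y))"

definition rack_model ::
  "'c set \<Rightarrow> ('c \<Rightarrow> 'c \<Rightarrow> 'c) \<Rightarrow> nat \<Rightarrow> nat \<Rightarrow> rack_sym trm set list \<Rightarrow> 'c list \<Rightarrow> 'c list" where
  "rack_model R b = action (rack_ops R b)"

definition set_model :: "nat \<Rightarrow> nat \<Rightarrow> rack_sym trm set list \<Rightarrow> 'c list \<Rightarrow> 'c list" where
  "set_model = action (\<lambda>f x y. y)"

lemma wf_rack [simp]: "wf_eqns UNIV rack_eqns" "wf_eqns UNIV quandle_eqns"
    "wf_eqns UNIV invo_eqns" "wf_eqns UNIV kei_eqns" "wf_eqns F {}"
  by (auto simp: wf_eqns_def rack_eqns_def quandle_eqns_def invo_eqns_def kei_eqns_def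
      idem_eqn_def invol_eqn_def intro!: exI[of _ "3::nat"] trms.intros)

lemma all_vals2: "(\<forall>v. (\<forall>i. v i \<in> A) \<longrightarrow> P (v 0) (v (1::nat))) \<longleftrightarrow> (\<forall>x\<in>A. \<forall>y\<in>A. P x y)"
proof (intro iffI ballI)
  fix x y assume h: "\<forall>v. (\<forall>i. v i \<in> A) \<longrightarrow> P (v 0) (v (1::nat))" "x \<in> A" "y \<in> A"
  show "P x y" using h(1)[rule_format, of "\<lambda>i. if i = 0 then x else y"] h by auto
qed auto

lemma all_vals1: "(\<forall>v. (\<forall>i::nat. v i \<in> A) \<longrightarrow> P (v 0)) \<longleftrightarrow> (\<forall>x\<in>A. P x)"
proof (intro iffI ballI)
  fix x assume h: "\<forall>v. (\<forall>i::nat. v i \<in> A) \<longrightarrow> P (v 0)" "x \<in> A"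
  show "P x" using h(1)[rule_format, of "\<lambda>i. x"] h by auto
qed auto

lemma all_vals3:
  "(\<forall>v. (\<forall>i. v i \<in> A) \<longrightarrow> P (v 0) (v (1::nat)) (v 2)) \<longleftrightarrow> (\<forall>x\<in>A. \<forall>y\<in>A. \<forall>z\<in>A. P x y z)"
proof (intro iffI ballI)
  fix x y z assume h: "\<forall>v. (\<forall>i. v i \<in> A) \<longrightarrow> P (v 0) (v (1::nat)) (v 2)" "x \<in> A" "y \<in> A" "z \<in> A"
  show "P x y z" using h(1)[rule_format, of "\<lambda>i. if i = 0 then x else if i = 1 then y else z"] h by auto
qed auto

lemma satisfies_rack:
  "satisfies A UNIV rack_eqns I \<longleftrightarrow>
     rack A (I Act) \<and> (\<forall>x\<in>A. \<forall>y\<in>A. I ActInv x y = inv_into A (I Act x) y)"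
proof -
  have closed: "(\<forall>f\<in>UNIV. \<forall>x\<in>A. \<forall>y\<in>A. I f x y \<in> A) \<longleftrightarrow>
      (\<forall>x\<in>A. \<forall>y\<in>A. I Act x y \<in> A) \<and> (\<forall>x\<in>A. \<forall>y\<in>A. I ActInv x y \<in> A)" (is "?l = ?r")
  proof
    assume ?r
    then have "\<forall>x\<in>A. \<forall>y\<in>A. I f x y \<in> A" for f by (cases f) simp_all
    then show ?l by blast
  qed blast
  have "satisfies A UNIV rack_eqns I \<longleftrightarrow>
     ((\<forall>x\<in>A. \<forall>y\<in>A. I Act x y \<in> A) \<and> (\<forall>x\<in>A. \<forall>y\<in>A. I ActInv x y \<in> A)) \<and>
     (\<forall>x\<in>A. \<forall>y\<in>A. I Act x (I ActInv x y) = y) \<and>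
     (\<forall>x\<in>A. \<forall>y\<in>A. I ActInv x (I Act x y) = y) \<and>
     (\<forall>x\<in>A. \<forall>y\<in>A. \<forall>z\<in>A. I Act x (I Act y z) = I Act (I Act x y) (I Act x z))"
    unfolding satisfies_def rack_eqns_def closed
      all_vals2[of A "\<lambda>x y. I Act x (I ActInv x y) = y", symmetric]
      all_vals2[of A "\<lambda>x y. I ActInv x (I Act x y) = y", symmetric]
      all_vals3[of A "\<lambda>x y z. I Act x (I Act y z) = I Act (I Act x y) (I Act x z)", symmetric]
    by simp
  also have "\<dots> \<longleftrightarrow> rack A (I Act) \<and> (\<forall>x\<in>A. \<forall>y\<in>A. I ActInv x y = inv_into A (I Act x) y)"
    (is "?L \<longleftrightarrow> ?R")
  proof
    assume L: ?L
    have b: "bij_betw (I Act x) A A" if "x \<in> A" for x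
      by (rule bij_betw_byWitness[where f' = "I ActInv x"]) (use L that in blast)+
    moreover have "I ActInv x y = inv_into A (I Act x) y" if "x \<in> A" "y \<in> A" for x y
    proof -
      have "I ActInv x y \<in> A" "I Act x (I ActInv x y) = y" using L that by blast+
      then show ?thesis using bij_betw_inv_into_left[OF b[OF that(1)], of "I ActInv x y"] by simp
    qed
    ultimately show ?R using L unfolding rack_def by blast
  next
    assume R: ?R
    have "I Act x y \<in> A \<and> I ActInv x y \<in> A \<and>
        I Act x (I ActInv x y) = y \<and> I ActInv x (I Act x y) = y" if xy: "x \<in> A" "y \<in> A" for x y
    proof -
      have b: "bij_betw (I Act x) A A" and e: "I ActInv x y = inv_into A (I Act x) y"
        using R xy unfolding rack_def by blast+
      have "I ActInv x (I Act x y) = inv_into A (I Act x) (I Act x y)"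
        using R xy bij_betw_apply[OF b xy(2)] by blast
      then show ?thesis
        using e bij_betw_apply[OF b xy(2)] bij_betw_apply[OF bij_betw_inv_into[OF b] xy(2)]
          bij_betw_inv_into_left[OF b xy(2)] bij_betw_inv_into_right[OF b xy(2)] by simp
    qed
    then show ?L using R unfolding rack_def by blast
  qed
  finally show ?thesis .
qed

lemma satisfies_insert:
  "satisfies A F (insert (l, r) E) I \<longleftrightarrow>
    satisfies A F E I \<and> (\<forall>v. (\<forall>i. v i \<in> A) \<longrightarrow> ev I v l = ev I v r)"
  unfolding satisfies_def by auto

lemma satisfies_rack_theories:
  "satisfies A UNIV quandle_eqns I \<longleftrightarrow>
     quandle A (I Act) \<and> (\<forall>x\<in>A. \<forall>y\<in>A. I ActInv x y = inv_into A (I Act x) y)"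
  "satisfies A UNIV invo_eqns I \<longleftrightarrow>
     involutary_rack A (I Act) \<and> (\<forall>x\<in>A. \<forall>y\<in>A. I ActInv x y = inv_into A (I Act x) y)"
  "satisfies A UNIV kei_eqns I \<longleftrightarrow>
     kei A (I Act) \<and> (\<forall>x\<in>A. \<forall>y\<in>A. I ActInv x y = inv_into A (I Act x) y)"
  unfolding quandle_eqns_def invo_eqns_def kei_eqns_def idem_eqn_def invol_eqn_def
    satisfies_insert satisfies_rack quandle_def involutary_rack_def kei_def
  using all_vals1[of A "\<lambda>x. I Act x x = x"] all_vals2[of A "\<lambda>x y. I Act x (I Act x y) = y"]
  by auto

lemma rack_ops_Act [simp]: "rack_ops R b Act = b" "rack_ops R b ActInv x y = inv_into R (b x) y"
  by (simp_all add: rack_ops_def)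

text \<open>The models of the four theories on a set \<open>R\<close> are the respective structures on \<open>R\<close>.\<close>

lemma models_of_structures:
  "rack R b \<Longrightarrow> model Rack_th R (rack_model R b)"
  "quandle R b \<Longrightarrow> model Quan_th R (rack_model R b)"
  "involutary_rack R b \<Longrightarrow> model Invo_th R (rack_model R b)"
  "kei R b \<Longrightarrow> model Kei_th R (rack_model R b)"
  "model Sets_th R set_model"
  unfolding Rack_th_def Quan_th_def Invo_th_def Kei_th_def Sets_th_def rack_model_def set_model_def
  by (auto intro!: model_action simp: satisfies_rack satisfies_rack_theories)
     (simp add: satisfies_def)

lemma structures_of_models:
  "model Rack_th R M \<Longrightarrow> \<exists>b. rack R b \<and> model_eq Rack_th R M (rack_model R b)"
  "model Quan_th R M \<Longrightarrow> \<exists>b. quandle R b \<and> model_eq Quan_th R M (rack_model R b)"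
  "model Invo_th R M \<Longrightarrow> \<exists>b. involutary_rack R b \<and> model_eq Invo_th R M (rack_model R b)"
  "model Kei_th R M \<Longrightarrow> \<exists>b. kei R b \<and> model_eq Kei_th R M (rack_model R b)"
  "model Sets_th R M \<Longrightarrow> model_eq Sets_th R M set_model"
proof -
  have *: "\<exists>b. Q b \<and> model_eq (Th UNIV E) R M (rack_model R b)"
    if "model (Th UNIV E) R M" and wf: "wf_eqns UNIV E"
      and Q: "\<And>I. satisfies R UNIV E I \<Longrightarrow>
        Q (I Act) \<and> (\<forall>x\<in>R. \<forall>y\<in>R. I ActInv x y = inv_into R (I Act x) y)" for E Q
  proof -
    from model_is_action[OF wf that(1)] obtain I
      where I: "satisfies R UNIV E I" "model_eq (Th UNIV E) R M (action I)" .
    have "I f x y = rack_ops R (I Act) f x y" if "x \<in> R" "y \<in> R" for f x y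
      using Q[OF I(1)] that by (cases f) auto
    then show ?thesis
      using action_agree[OF wf satisfies_closed[OF I(1)], of "rack_ops R (I Act)"] I(2) Q[OF I(1)]
      by (auto simp: model_eq_def rack_model_def intro!: exI[of _ "I Act"])
  qed
  show "model Rack_th R M \<Longrightarrow> \<exists>b. rack R b \<and> model_eq Rack_th R M (rack_model R b)"
    unfolding Rack_th_def by (rule *) (auto simp: satisfies_rack)
  show "model Quan_th R M \<Longrightarrow> \<exists>b. quandle R b \<and> model_eq Quan_th R M (rack_model R b)"
    unfolding Quan_th_def by (rule *) (auto simp: satisfies_rack_theories)
  show "model Invo_th R M \<Longrightarrow> \<exists>b. involutary_rack R b \<and> model_eq Invo_th R M (rack_model R b)"
    unfolding Invo_th_def by (rule *) (auto simp: satisfies_rack_theories)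
  show "model Kei_th R M \<Longrightarrow> \<exists>b. kei R b \<and> model_eq Kei_th R M (rack_model R b)"
    unfolding Kei_th_def by (rule *) (auto simp: satisfies_rack_theories)
  show "model Sets_th R M \<Longrightarrow> model_eq Sets_th R M set_model"
  proof -
    assume "model Sets_th R M"
    then have m: "model (Th {} {}) R M" by (simp add: Sets_th_def)
    have wf: "wf_eqns {} {}" by simp
    from model_is_action[OF wf m] obtain I
      where I: "satisfies R {} {} I" "model_eq (Th {} {}) R M (action I)" .
    then show ?thesis using action_agree[OF wf satisfies_closed[OF I(1)], of "\<lambda>f x y. y"]
      by (auto simp: model_eq_def set_model_def Sets_th_def)
  qed
qed

lemma rack_hom_iff_model_hom:
  assumes "rack R b" "rack S b'"
  shows "model_hom Rack_th R (rack_model R b) S (rack_model S b') h \<longleftrightarrow>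
    h ` R \<subseteq> S \<and> (\<forall>x\<in>R. \<forall>y\<in>R. h (b x y) = b' (h x) (h y))"
proof -
  have sR: "satisfies R UNIV rack_eqns (rack_ops R b)"
    and sS: "satisfies S UNIV rack_eqns (rack_ops S b')"
    using assms by (auto simp: satisfies_rack)
  show ?thesis
  proof (intro iffI conjI ballI)
    assume m: "model_hom Rack_th R (rack_model R b) S (rack_model S b') h"
    then show hS: "h ` R \<subseteq> S" by (simp add: model_hom_def)
    fix x y assume xy: "x \<in> R" "y \<in> R"
    let ?f = "map (cls UNIV rack_eqns 2) [App Act X0 X1]"
    have f: "?f \<in> Hom Rack_th 2 1"
      unfolding Rack_th_def Hom_Th by (rule exI[of _ "[App Act X0 X1]"]) simp
    have p: "[x, y] \<in> pows R 2" "map h [x, y] \<in> pows S 2"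
      using xy hS by (auto simp: pows_def)
    have "map h (rack_model R b 2 1 ?f [x, y]) = rack_model S b' 2 1 ?f (map h [x, y])"
      using m f p(1) unfolding model_hom_def by blast
    then show "h (b x y) = b' (h x) (h y)"
      using action_cls[OF sR _ p(1), of "[App Act X0 X1]"]
        action_cls[OF sS _ p(2), of "[App Act X0 X1]"]
      by (simp add: rack_model_def)
  next
    assume h: "h ` R \<subseteq> S \<and> (\<forall>x\<in>R. \<forall>y\<in>R. h (b x y) = b' (h x) (h y))"
    have inv: "h (inv_into R (b x) y) = inv_into S (b' (h x)) (h y)" if "x \<in> R" "y \<in> R" for x y
    proof -
      have bR: "bij_betw (b x) R R" and bS: "bij_betw (b' (h x)) S S"
        using assms h that by (auto simp: rack_def)
      let ?z = "inv_into R (b x) y"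
      have z: "?z \<in> R" "b x ?z = y"
        using bR that by (auto simp: bij_betw_inv_into_right bij_betw_apply[OF bij_betw_inv_into])
      then have "b' (h x) (h ?z) = h y" using h that by metis
      then show ?thesis using bS h z by (metis bij_betw_inv_into_left image_subset_iff)
    qed
    have hom: "h (rack_ops R b f x y) = rack_ops S b' f (h x) (h y)" if "x \<in> R" "y \<in> R" for f x y
      using h inv that by (cases f) auto
    have e: "h (ev (rack_ops R b) v t) = ev (rack_ops S b') (\<lambda>i. h (v i)) t"
      if "t \<in> trms UNIV m" "\<And>i. i < m \<Longrightarrow> v i \<in> R" for m v t
      using that(1)
    proof (induction rule: trms.induct)
      case (App f s t)
      have "ev (rack_ops R b) v s \<in> R" "ev (rack_ops R b) v t \<in> R"
        using App that(2) ev_in[OF _ sR] by blast+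
      then show ?case using App hom by simp
    qed simp
    show "model_hom Rack_th R (rack_model R b) S (rack_model S b') h"
      unfolding model_hom_def
    proof (intro conjI allI ballI)
      show "h ` R \<subseteq> S" using h by blast
      fix m n f xs assume "f \<in> Hom Rack_th m n" and xs: "xs \<in> pows R m"
      then obtain ts where ts: "set ts \<subseteq> trms UNIV m" "f = map (cls UNIV rack_eqns m) ts"
        by (auto simp: Hom_Th Rack_th_def)
      have hxs: "map h xs \<in> pows S m" using conjunct1[OF h] xs unfolding pows_def by fastforce
      have "h (ev (rack_ops R b) (\<lambda>i. xs ! i) t) = ev (rack_ops S b') (\<lambda>i. map h xs ! i) t"
        if "t \<in> set ts" for t
      proof -
        have t: "t \<in> trms UNIV m" using that ts by auto
        have "h (ev (rack_ops R b) (\<lambda>i. xs ! i) t) = ev (rack_ops S b') (\<lambda>i. h (xs ! i)) t"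
          using xs by (intro e[OF t]) (auto simp: pows_def)
        also have "\<dots> = ev (rack_ops S b') (\<lambda>i. map h xs ! i) t"
          using xs by (intro ev_cong[OF t]) (auto simp: pows_def)
        finally show ?thesis .
      qed
      then show "map h (rack_model R b m n f xs) = rack_model S b' m n f (map h xs)"
        using action_cls[OF sR ts(1) xs] action_cls[OF sS ts(1) hxs] ts
        by (simp add: rack_model_def)
    qed
  qed
qed

text \<open>
  The right adjoints of the morphisms are the prescribed functors: \<open>(R, b) \<mapsto> (R, b\<^sup>2)\<close> for
  \<open>Psi2\<close>, the trivial structure for \<open>triv_mor\<close>, the inclusions and the underlying set.
\<close>

lemma inv_into_sq:
  assumes "bij_betw g R R" "y \<in> R"
  shows "inv_into R g (inv_into R g y) = inv_into R (\<lambda>z. g (g z)) y"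
proof -
  let ?z = "inv_into R g (inv_into R g y)"
  have z: "?z \<in> R" "g (g ?z) = y"
    using assms by (auto simp: bij_betw_inv_into_right bij_betw_apply[OF bij_betw_inv_into])
  have "bij_betw (\<lambda>z. g (g z)) R R"
    using bij_betw_trans[OF assms(1) assms(1)] by (simp add: comp_def)
  then show ?thesis using z by (metis (no_types, lifting) bij_betw_inv_into_left)
qed

lemma Psi2_right_adjoint_gen:
  assumes "wf_eqns UNIV E" "satisfies R UNIV E (rack_ops R b)" "rack R b"
  shows "model_eq (Th UNIV E) R
    (\<lambda>m n f. rack_model R b m n (interp_mor UNIV E Psi2_interp m n f))
    (rack_model R (\<lambda>x y. b x (b x y)))"
  unfolding model_eq_def
proof (intro allI ballI)
  fix m n f xs assume f: "f \<in> Hom (Th UNIV E) m n" and xs: "xs \<in> pows R m"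
  let ?I = "rack_ops R b" and ?J = "rack_ops R (\<lambda>x y. b x (b x y))"
  let ?K = "\<lambda>f x y. ev ?I (\<lambda>i. if i = 0 then x else y) (Psi2_interp f)"
  have K: "?K f x y = ?J f x y" if "x \<in> R" "y \<in> R" for f x y
    using that assms(3) by (cases f) (auto simp: Psi2_interp_def rack_def inv_into_sq)
  have "Psi2_interp f \<in> trms UNIV 2" for f by (simp add: Psi2_interp_def)
  then have "rack_model R b m n (interp_mor UNIV E Psi2_interp m n f) xs = action ?K m n f xs"
    unfolding rack_model_def by (intro action_interp[OF assms(1) _ assms(2) f xs])
  also have "\<dots> = action ?J m n f xs"
  proof (rule action_agree[OF assms(1) _ K f xs])
    have "b x y \<in> R" "inv_into R (b x) y \<in> R" if "x \<in> R" "y \<in> R" for x y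
      using bspec[OF bspec[OF bspec[OF conjunct1[OF assms(2)[unfolded satisfies_def]], of Act]], of x y]
        bspec[OF bspec[OF bspec[OF conjunct1[OF assms(2)[unfolded satisfies_def]], of ActInv]], of x y]
        that by simp_all
    then have "?K g x y \<in> R" if "x \<in> R" "y \<in> R" for g x y
      using that by (cases g) (simp_all add: Psi2_interp_def)
    then show "satisfies R UNIV {} ?K" by (simp add: satisfies_def)
  qed
  finally show "rack_model R b m n (interp_mor UNIV E Psi2_interp m n f) xs =
    rack_model R (\<lambda>x y. b x (b x y)) m n f xs" by (simp add: rack_model_def)
qed

lemma Psi2_right_adjoint:
  "rack R b \<Longrightarrow> model_eq Rack_th R (\<lambda>m n f. rack_model R b m n (Psi2_Rack m n f))
     (rack_model R (\<lambda>x y. b x (b x y)))"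
  "quandle R b \<Longrightarrow> model_eq Quan_th R (\<lambda>m n f. rack_model R b m n (Psi2_Quan m n f))
     (rack_model R (\<lambda>x y. b x (b x y)))"
  unfolding Rack_th_def Quan_th_def Psi2_Rack_def Psi2_Quan_def
  by (auto intro!: Psi2_right_adjoint_gen simp: satisfies_rack satisfies_rack_theories quandle_def)

lemma triv_right_adjoint:
  "model_eq Rack_th R (\<lambda>m n f. set_model m n (triv_mor m n f)) (rack_model R (\<lambda>x y. y))"
  "model_eq Quan_th R (\<lambda>m n f. set_model m n (triv_mor m n f)) (rack_model R (\<lambda>x y. y))"
proof -
  have bij: "bij_betw (\<lambda>y. y) R R" by (simp add: bij_betw_def)
  have inv: "inv_into R (\<lambda>y. y) y = y" if "y \<in> R" for y
    using bij_betw_inv_into_left[OF bij that] by simp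
  have *: "model_eq (Th UNIV E) R (\<lambda>m n f. set_model m n (triv_mor m n f)) (rack_model R (\<lambda>x y. y))"
    if wf: "wf_eqns UNIV E" and sat: "satisfies R UNIV E (rack_ops R (\<lambda>x y. y))" for E
    unfolding model_eq_def
  proof (intro allI ballI)
    fix m n f xs assume f: "f \<in> Hom (Th UNIV E) m n" and xs: "xs \<in> pows R m"
    have "set_model m n (triv_mor m n f) xs = action (\<lambda>g x y. y) m n f xs"
      unfolding set_model_def triv_mor_def
      by (subst action_interp[OF wf _ _ f xs]) (simp_all add: trivial_interp_def satisfies_def)
    also have "\<dots> = rack_model R (\<lambda>x y. y) m n f xs" unfolding rack_model_def
    proof (rule action_agree[OF wf satisfies_closed[OF sat] _ f xs, symmetric])
      fix g x y assume "x \<in> R" "y \<in> R"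
      then show "rack_ops R (\<lambda>x y. y) g x y = y" using inv by (cases g) auto
    qed
    finally show "set_model m n (triv_mor m n f) xs = rack_model R (\<lambda>x y. y) m n f xs" .
  qed
  have q: "quandle R (\<lambda>x y. y)" by (simp add: quandle_def rack_def bij)
  show "model_eq Rack_th R (\<lambda>m n f. set_model m n (triv_mor m n f)) (rack_model R (\<lambda>x y. y))"
    unfolding Rack_th_def using q by (intro *) (auto simp: satisfies_rack quandle_def)
  show "model_eq Quan_th R (\<lambda>m n f. set_model m n (triv_mor m n f)) (rack_model R (\<lambda>x y. y))"
    unfolding Quan_th_def using q by (intro *) (auto simp: satisfies_rack_theories)
qed

lemma incl_right_adjoint_gen:
  assumes "wf_eqns F E" "F \<subseteq> F'" "satisfies R F' E' I"
  shows "model_eq (Th F E) R (\<lambda>m n f. action I m n (interp_mor F' E' same_interp m n f)) (action I)"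
  unfolding model_eq_def
proof (intro allI ballI)
  fix m n f xs assume f: "f \<in> Hom (Th F E) m n" and xs: "xs \<in> pows R m"
  have "same_interp g \<in> trms F' 2" if "g \<in> F" for g
    using that assms(2) by (auto simp: same_interp_def)
  then show "action I m n (interp_mor F' E' same_interp m n f) xs = action I m n f xs"
    by (subst action_interp[OF assms(1) _ assms(3) f xs]) (simp_all add: same_interp_def)
qed

lemma incl_right_adjoint:
  "involutary_rack R b \<Longrightarrow>
     model_eq Rack_th R (\<lambda>m n f. rack_model R b m n (incl_Invo m n f)) (rack_model R b)"
  "kei R b \<Longrightarrow> model_eq Quan_th R (\<lambda>m n f. rack_model R b m n (incl_Kei m n f)) (rack_model R b)"
  unfolding Rack_th_def Quan_th_def incl_Invo_def incl_Kei_def rack_model_def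
  by (auto intro!: incl_right_adjoint_gen simp: satisfies_rack_theories)

lemma struct_right_adjoint:
  "involutary_rack R b \<Longrightarrow>
     model_eq Sets_th R (\<lambda>m n f. rack_model R b m n (struct_Invo m n f)) set_model"
  "kei R b \<Longrightarrow> model_eq Sets_th R (\<lambda>m n f. rack_model R b m n (struct_Kei m n f)) set_model"
proof -
  have wf: "wf_eqns {} {}" by simp
  have *: "model_eq (Th {} {}) R (\<lambda>m n f. action I m n (interp_mor UNIV E' same_interp m n f)) set_model"
    if sat: "satisfies R UNIV E' I" for E' I
  proof -
    have "action I m n f xs = set_model m n f xs"
      if "f \<in> Hom (Th {} {}) m n" "xs \<in> pows R m" for m n f xs
      unfolding set_model_def
      by (rule action_agree[OF wf _ _ that]) (simp_all add: satisfies_def)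
    then show ?thesis using incl_right_adjoint_gen[OF wf _ sat] by (simp add: model_eq_def)
  qed
  show "involutary_rack R b \<Longrightarrow>
     model_eq Sets_th R (\<lambda>m n f. rack_model R b m n (struct_Invo m n f)) set_model"
    unfolding Sets_th_def struct_Invo_def rack_model_def
    by (rule *) (simp add: satisfies_rack_theories)
  show "kei R b \<Longrightarrow> model_eq Sets_th R (\<lambda>m n f. rack_model R b m n (struct_Kei m n f)) set_model"
    unfolding Sets_th_def struct_Kei_def rack_model_def
    by (rule *) (simp add: satisfies_rack_theories)
qed

end

theory Submission
  imports Defs
begin

text \<open>
  A morphism out of the theory of racks or quandles factors through the theory presented by one
  more equation as soon as it identifies the two sides of that equation. If \<open>p\<close> and \<open>q\<close>
  agree on the images of \<open>x \<rhd> y\<close>, then \<open>p\<close> sends \<open>x \<rhd> (x \<rhd> y)\<close> to the image under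
  \<open>q\<close> of the projection to \<open>y\<close>, which is again a projection: this is the involutivity equation.
  Provable equality in the presented theories is reduced to identities in all their models by
  means of the free algebras.
\<close>

section \<open>Free algebras\<close>

text \<open>The operation of the free algebra is computed on chosen representatives, which makes it
  a total function that \<open>ev\<close> accepts. Congruence of \<open>eqv\<close> makes the choice
  immaterial on classes of terms, as \<open>free_op_cls\<close> records.\<close>

definition free_op ::
  "'f set \<Rightarrow> ('f trm \<times> 'f trm) set \<Rightarrow> nat \<Rightarrow> 'f \<Rightarrow> 'f trm set \<Rightarrow> 'f trm set \<Rightarrow> 'f trm set" where
  "free_op F E m f c d = cls F E m (App f (rep c) (rep d))"

lemma free_op_cls:
  assumes "f \<in> F" "s \<in> trms F m" "t \<in> trms F m"
  shows "free_op F E m f (cls F E m s) (cls F E m t) = cls F E m (App f s t)"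
  unfolding free_op_def
  using assms by (intro cls_eq eqv.cong) (auto intro: eqv.sym[OF rep_cls])

lemma ev_free_op:
  assumes "t \<in> trms F n" "\<And>i. i < n \<Longrightarrow> \<tau> i \<in> trms F m"
  shows "ev (free_op F E m) (\<lambda>i. cls F E m (\<tau> i)) t = cls F E m (subst \<tau> t)"
  using assms by (induction rule: trms.induct) (auto simp: free_op_cls subst_trms)

text \<open>A valuation in the free algebra lifts to a substitution \<open>\<tau>\<close>. Under it
  the two sides of an equation become an instance of \<open>ax\<close>, so their classes
  coincide.\<close>

lemma satisfies_free_op:
  assumes "wf_eqns F E"
  shows "satisfies (cls F E m ` trms F m) F E (free_op F E m)"
proof -
  have "ev (free_op F E m) v l = ev (free_op F E m) v r"
    if lr: "(l, r) \<in> E" and v: "\<forall>i. v i \<in> cls F E m ` trms F m" for l r v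
  proof -
    from v have "\<forall>i. \<exists>t. t \<in> trms F m \<and> v i = cls F E m t" by blast
    then obtain \<tau> where \<tau>: "\<And>i. \<tau> i \<in> trms F m" "v = (\<lambda>i. cls F E m (\<tau> i))" by metis
    obtain n where "l \<in> trms F n" "r \<in> trms F n" using assms lr by (auto simp: wf_eqns_def)
    then show ?thesis
      using \<tau> ev_free_op[of _ F n \<tau> m E] cls_eq[OF eqv.ax[OF lr, where \<sigma> = \<tau>]] by simp
  qed
  then show ?thesis by (auto simp: satisfies_def free_op_cls)
qed

lemma eqv_of_cls_eq: "t \<in> trms F m \<Longrightarrow> cls F E m s = cls F E m t \<Longrightarrow> eqv F E m s t"
  unfolding cls_def by (auto intro: eqv.refl)

text \<open>Birkhoff completeness: in the free algebra, at the valuation sending each variable to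
  its own class, a term evaluates to its own class. Carriers are sets of classes of terms, the type
  in which the free algebra lives.\<close>

lemma eqv_complete:
  fixes F :: "'f set"
  assumes "wf_eqns F E" "s \<in> trms F m" "t \<in> trms F m"
    and "\<And>(A :: 'f trm set set) I v. satisfies A F E I \<Longrightarrow> (\<And>i. i < m \<Longrightarrow> v i \<in> A) \<Longrightarrow>
      ev I v s = ev I v t"
  shows "eqv F E m s t"
proof -
  have id: "subst Var t = t" for t :: "'f trm" by (induction t) auto
  have "ev (free_op F E m) (\<lambda>i. cls F E m (Var i)) s = ev (free_op F E m) (\<lambda>i. cls F E m (Var i)) t"
    by (rule assms(4)[OF satisfies_free_op[OF assms(1)]]) auto
  then have "cls F E m s = cls F E m t"
    using ev_free_op[OF assms(2), of Var m E] ev_free_op[OF assms(3), of Var m E] by (simp add: id)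
  then show ?thesis using assms(3) by (intro eqv_of_cls_eq)
qed

section \<open>Presented theories and their morphisms\<close>

lemma Hom_ThE:
  assumes "f \<in> Hom (Th F E) m n"
  obtains ts where "length ts = n" "set ts \<subseteq> trms F m" "f = map (cls F E m) ts"
  using assms by (auto simp: Hom_Th)

lemma Hom_ThI: "length ts = n \<Longrightarrow> set ts \<subseteq> trms F m \<Longrightarrow> map (cls F E m) ts \<in> Hom (Th F E) m n"
  by (auto simp: Hom_Th)

lemma Id_Th: "Id (Th F E) n = map (cls F E n) (map Var [0..<n])"
  by (simp add: Th_def)

lemma Proj_Th: "Proj (Th F E) n i = map (cls F E n) [Var i]"
  by (simp add: Th_def)

lemma Comp_Th':
  assumes "wf_eqns F E" "set ts \<subseteq> trms F m" "length us = m" "set us \<subseteq> trms F k"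
  shows "Comp (Th F E) k m n (map (cls F E m) ts) (map (cls F E k) us) =
    map (cls F E k) (map (subst (\<lambda>i. us ! i)) ts)"
  using Comp_Th[OF assms] by simp

lemma subst_nth_trms:
  assumes "set ts \<subseteq> trms F m" "length us = m" "set us \<subseteq> trms F k"
  shows "set (map (subst (\<lambda>i. us ! i)) ts) \<subseteq> trms F k"
  using assms by (auto intro!: subst_trms)

lemma Comp_Proj_Th:
  assumes "wf_eqns F E" "length ts = n" "set ts \<subseteq> trms F m" "i < n"
  shows "Comp (Th F E) m n 1 (Proj (Th F E) n i) (map (cls F E m) ts) = [cls F E m (ts ! i)]"
  unfolding Proj_Th using assms by (subst Comp_Th') auto

text \<open>On lists of terms representing the arrows, composition is simultaneous substitution. The
  category laws become laws of substitution, and the product property says that a list of classes is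
  determined by its entries.\<close>

lemma lawvere_theory_Th:
  assumes wf: "wf_eqns F E"
  shows "lawvere_theory (Th F E)"
  unfolding lawvere_theory_def
proof (intro conjI allI ballI impI)
  fix n show "Id (Th F E) n \<in> Hom (Th F E) n n"
    unfolding Id_Th by (rule Hom_ThI) auto
next
  fix k m n f g assume "f \<in> Hom (Th F E) m n" "g \<in> Hom (Th F E) k m"
  then show "Comp (Th F E) k m n f g \<in> Hom (Th F E) k n"
    by (elim Hom_ThE) (simp only: Comp_Th'[OF wf], rule Hom_ThI, simp, rule subst_nth_trms)
next
  fix m n f assume "f \<in> Hom (Th F E) m n"
  then obtain ts where ts: "length ts = n" "set ts \<subseteq> trms F m" "f = map (cls F E m) ts"
    by (rule Hom_ThE)
  \<comment> \<open>List lookup is specified only below \<open>m\<close>, hence the restriction to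
    terms in \<open>m\<close> variables.\<close>
  have "subst (\<lambda>i. map Var [0..<m] ! i) t = t" if "t \<in> trms F m" for t :: "'a trm"
    using that by (induction rule: trms.induct) auto
  then show "Comp (Th F E) m m n f (Id (Th F E) m) = f"
    unfolding ts(3) Id_Th using ts by (subst Comp_Th'[OF wf]) (auto simp: comp_def)
  show "Comp (Th F E) m n n (Id (Th F E) n) f = f"
    unfolding ts(3) Id_Th using ts
    by (subst Comp_Th'[OF wf]) (auto intro!: nth_equalityI)
next
  fix j k m n f g h
  assume "f \<in> Hom (Th F E) m n" "g \<in> Hom (Th F E) k m" "h \<in> Hom (Th F E) j k"
  then obtain ts us ws
    where ts: "length ts = n" "set ts \<subseteq> trms F m" "f = map (cls F E m) ts"
      and us: "length us = m" "set us \<subseteq> trms F k" "g = map (cls F E k) us"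
      and ws: "length ws = k" "set ws \<subseteq> trms F j" "h = map (cls F E j) ws"
    by (elim Hom_ThE) blast
  have "subst (\<lambda>i. map (subst (\<lambda>i. ws ! i)) us ! i) t =
      subst (\<lambda>i. ws ! i) (subst (\<lambda>i. us ! i) t)" if "t \<in> set ts" for t
    unfolding subst_subst using that ts us by (intro subst_cong[of _ F m]) auto
  then show "Comp (Th F E) j m n f (Comp (Th F E) j k m g h) =
      Comp (Th F E) j k n (Comp (Th F E) k m n f g) h"
    unfolding ts(3) us(3) ws(3)
    using ts us ws subst_nth_trms[OF ts(2) us(1,2)] subst_nth_trms[OF us(2) ws(1,2)]
    by (simp add: Comp_Th'[OF wf] del: map_map) simp
next
  fix n i assume "i < (n::nat)"
  then show "Proj (Th F E) n i \<in> Hom (Th F E) n 1"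
    unfolding Proj_Th by (intro Hom_ThI) auto
next
  show "Proj (Th F E) 1 0 = Id (Th F E) 1" by (simp add: Proj_Th Id_Th)
next
  fix m n :: nat and u assume "\<forall>i<n. u i \<in> Hom (Th F E) m 1"
  then have "\<forall>i<n. \<exists>t. t \<in> trms F m \<and> u i = [cls F E m t]"
    by (fastforce elim: Hom_ThE simp: length_Suc_conv)
  then obtain t where t: "\<And>i. i < n \<Longrightarrow> t i \<in> trms F m \<and> u i = [cls F E m (t i)]" by metis
  show "\<exists>!h. h \<in> Hom (Th F E) m n \<and>
      (\<forall>i<n. Comp (Th F E) m n 1 (Proj (Th F E) n i) h = u i)"
  proof (intro ex1I conjI allI impI)
    show "map (cls F E m) (map t [0..<n]) \<in> Hom (Th F E) m n"
      using t by (intro Hom_ThI) auto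
    show "Comp (Th F E) m n 1 (Proj (Th F E) n i) (map (cls F E m) (map t [0..<n])) = u i"
      if "i < n" for i
      using that t by (subst Comp_Proj_Th[OF wf]) auto
  next
    fix h assume h: "h \<in> Hom (Th F E) m n \<and>
      (\<forall>i<n. Comp (Th F E) m n 1 (Proj (Th F E) n i) h = u i)"
    then obtain ts where ts: "length ts = n" "set ts \<subseteq> trms F m" "h = map (cls F E m) ts"
      by (auto elim: Hom_ThE)
    have "cls F E m (ts ! i) = cls F E m (t i)" if "i < n" for i
      using h t[OF that] Comp_Proj_Th[OF wf ts(1,2) that] that ts(3) by auto
    then show "h = map (cls F E m) (map t [0..<n])"
      using ts by (auto intro!: nth_equalityI)
  qed
qed

section \<open>Morphisms induced by interpretations\<close>

lemma rep_cls_trms: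
  assumes "wf_eqns F E" "t \<in> trms F m"
  shows "rep (cls F E m t) \<in> trms F m"
  using eqv_trms[OF assms(1) rep_cls[OF assms(2)]] by simp

lemma translate_subst:
  assumes "\<And>f. f \<in> F \<Longrightarrow> \<sigma> f \<in> trms F' 2" "t \<in> trms F m"
  shows "translate \<sigma> (subst \<tau> t) = subst (\<lambda>i. translate \<sigma> (\<tau> i)) (translate \<sigma> t)"
  using assms(2)
proof (induction rule: trms.induct)
  case (App f s t)
  then show ?case by (auto simp: subst_subst intro!: subst_cong[OF assms(1)])
qed simp

text \<open>Only models on sets of classes of terms are needed, since these include the free algebras.\<close>

definition interprets ::
  "'f set \<Rightarrow> ('f trm \<times> 'f trm) set \<Rightarrow> 'g set \<Rightarrow> ('g trm \<times> 'g trm) set \<Rightarrow> ('f \<Rightarrow> 'g trm) \<Rightarrow> bool"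
where
  "interprets F E F' E' \<sigma> \<longleftrightarrow> (\<forall>f\<in>F. \<sigma> f \<in> trms F' 2) \<and>
    (\<forall>(A :: 'g trm set set) I. satisfies A F' E' I \<longrightarrow>
      satisfies A F E (\<lambda>f x y. ev I (\<lambda>i. if i = 0 then x else y) (\<sigma> f)))"

lemma interprets_trms:
  assumes "interprets F E F' E' \<sigma>" "t \<in> trms F m"
  shows "translate \<sigma> t \<in> trms F' m"
  using translate_trms[of F \<sigma> F'] assms unfolding interprets_def by blast

text \<open>This is independence of the representative. Each model of \<open>E'\<close> becomes a
  model of \<open>E\<close> along \<open>\<sigma>\<close>, where a term and its representative have
  equal values by soundness. Completeness turns this agreement into provable equality of the
  translations.\<close>

lemma interp_mor_cls:
  fixes \<sigma> :: "'f \<Rightarrow> 'g trm"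
  assumes wf: "wf_eqns F E" "wf_eqns F' E'" and \<sigma>: "interprets F E F' E' \<sigma>"
    and "set ts \<subseteq> trms F m"
  shows "interp_mor F' E' \<sigma> m n (map (cls F E m) ts) = map (cls F' E' m) (map (translate \<sigma>) ts)"
proof -
  have "eqv F' E' m (translate \<sigma> (rep (cls F E m t))) (translate \<sigma> t)" if "t \<in> trms F m" for t
  proof (rule eqv_complete[OF wf(2)])
    show "translate \<sigma> (rep (cls F E m t)) \<in> trms F' m" "translate \<sigma> t \<in> trms F' m"
      using interprets_trms[OF \<sigma>] rep_cls_trms[OF wf(1)] that by blast+
  next
    fix A :: "'g trm set set" and I v
    assume "satisfies A F' E' I" and v: "\<And>i. i < m \<Longrightarrow> v i \<in> A"
    then have "satisfies A F E (\<lambda>f x y. ev I (\<lambda>i. if i = 0 then x else y) (\<sigma> f))"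
      using \<sigma> unfolding interprets_def by blast
    then show "ev I v (translate \<sigma> (rep (cls F E m t))) = ev I v (translate \<sigma> t)"
      unfolding ev_translate by (rule eqv_sound[OF eqv.sym[OF rep_cls[OF that]] _ v])
  qed
  then show ?thesis using assms(4) by (auto simp: interp_mor_def intro!: cls_eq)
qed

lemma theory_morphism_interp_mor:
  fixes \<sigma> :: "'f \<Rightarrow> 'g trm"
  assumes wf: "wf_eqns F E" "wf_eqns F' E'" and \<sigma>: "interprets F E F' E' \<sigma>"
  shows "theory_morphism (Th F E) (Th F' E') (interp_mor F' E' \<sigma>)"
proof -
  note cl = interp_mor_cls[OF wf \<sigma>]
  have tr: "set (map (translate \<sigma>) ts) \<subseteq> trms F' m" if "set ts \<subseteq> trms F m" for ts m
    using that interprets_trms[OF \<sigma>] by fastforce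
  show ?thesis
    unfolding theory_morphism_def
  proof (intro conjI allI ballI impI)
    fix m n f assume "f \<in> Hom (Th F E) m n"
    then show "interp_mor F' E' \<sigma> m n f \<in> Hom (Th F' E') m n"
      by (elim Hom_ThE) (simp only: cl, rule Hom_ThI, simp, rule tr)
  next
    fix n show "interp_mor F' E' \<sigma> n n (Id (Th F E) n) = Id (Th F' E') n"
      unfolding Id_Th by (subst cl) auto
  next
    fix k m n f g assume "f \<in> Hom (Th F E) m n" "g \<in> Hom (Th F E) k m"
    then obtain ts us
      where ts: "length ts = n" "set ts \<subseteq> trms F m" "f = map (cls F E m) ts"
        and us: "length us = m" "set us \<subseteq> trms F k" "g = map (cls F E k) us"
      by (elim Hom_ThE) blast
    have "translate \<sigma> (subst (\<lambda>i. us ! i) t) =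
        subst (\<lambda>i. map (translate \<sigma>) us ! i) (translate \<sigma> t)" if "t \<in> set ts" for t
    proof -
      have t: "t \<in> trms F m" using that ts by blast
      have "translate \<sigma> (subst (\<lambda>i. us ! i) t) =
          subst (\<lambda>i. translate \<sigma> (us ! i)) (translate \<sigma> t)"
        using \<sigma> t unfolding interprets_def by (intro translate_subst[of F \<sigma> F']) auto
      also have "\<dots> = subst (\<lambda>i. map (translate \<sigma>) us ! i) (translate \<sigma> t)"
        using us by (intro subst_cong[OF interprets_trms[OF \<sigma> t]]) simp
      finally show ?thesis .
    qed
    then show "interp_mor F' E' \<sigma> k n (Comp (Th F E) k m n f g) =
        Comp (Th F' E') k m n (interp_mor F' E' \<sigma> m n f) (interp_mor F' E' \<sigma> k m g)"
      using ts us subst_nth_trms[OF ts(2) us(1,2)] tr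
      by (simp add: Comp_Th'[OF wf(1)] Comp_Th'[OF wf(2)] cl del: map_map) simp
  next
    fix n i assume "i < (n::nat)"
    then show "interp_mor F' E' \<sigma> n 1 (Proj (Th F E) n i) = Proj (Th F' E') n i"
      unfolding Proj_Th by (subst cl) auto
  qed
qed

section \<open>Arrows and morphisms determined by components\<close>

lemma lawvere_theory_tuple:
  assumes "lawvere_theory X" "\<And>i. i < n \<Longrightarrow> u i \<in> Hom X m 1"
  shows "\<exists>!h. h \<in> Hom X m n \<and> (\<forall>i<n. Comp X m n 1 (Proj X n i) h = u i)"
proof -
  have "\<forall>m n u. (\<forall>i<n. u i \<in> Hom X m 1) \<longrightarrow>
      (\<exists>!h. h \<in> Hom X m n \<and> (\<forall>i<n. Comp X m n 1 (Proj X n i) h = u i))"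
    using assms(1) unfolding lawvere_theory_def by (elim conjE)
  from this[rule_format, OF assms(2)] show ?thesis by simp
qed

lemma lawvere_theory_component:
  assumes "lawvere_theory X" "h \<in> Hom X m n" "i < n"
  shows "Comp X m n 1 (Proj X n i) h \<in> Hom X m 1"
proof -
  have "\<forall>k m n. \<forall>f\<in>Hom X m n. \<forall>g\<in>Hom X k m. Comp X k m n f g \<in> Hom X k n"
    and "\<forall>n. \<forall>i<n. Proj X n i \<in> Hom X n 1"
    using assms(1) unfolding lawvere_theory_def by simp_all
  then show ?thesis using assms(2,3) by simp
qed

text \<open>Both arrows solve the tupling problem posed by the components of \<open>h'\<close>, and
  that problem has only one solution.\<close>

lemma lawvere_theory_ext:
  assumes "lawvere_theory X" "h \<in> Hom X m n" "h' \<in> Hom X m n"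
    "\<And>i. i < n \<Longrightarrow> Comp X m n 1 (Proj X n i) h = Comp X m n 1 (Proj X n i) h'"
  shows "h = h'"
proof -
  have "\<exists>!g. g \<in> Hom X m n \<and>
      (\<forall>i<n. Comp X m n 1 (Proj X n i) g = Comp X m n 1 (Proj X n i) h')"
    by (rule lawvere_theory_tuple[OF assms(1) lawvere_theory_component[OF assms(1,3)]])
  then show ?thesis using assms(2-4) by (elim ex1E) metis
qed

lemma theory_morphism_Hom: "theory_morphism S T F \<Longrightarrow> f \<in> Hom S m n \<Longrightarrow> F m n f \<in> Hom T m n"
  unfolding theory_morphism_def by blast

lemma theory_morphism_Comp:
  "theory_morphism S T F \<Longrightarrow> f \<in> Hom S m n \<Longrightarrow> g \<in> Hom S k m \<Longrightarrow>
    F k n (Comp S k m n f g) = Comp T k m n (F m n f) (F k m g)"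
  unfolding theory_morphism_def by blast

lemma theory_morphism_Proj:
  "theory_morphism S T F \<Longrightarrow> i < n \<Longrightarrow> F n 1 (Proj S n i) = Proj T n i"
  unfolding theory_morphism_def by blast

lemma theory_morphism_component:
  assumes "wf_eqns F E" "theory_morphism (Th F E) X p"
    "length ts = n" "set ts \<subseteq> trms F m" "i < n"
  shows "Comp X m n 1 (Proj X n i) (p m n (map (cls F E m) ts)) = p m 1 [cls F E m (ts ! i)]"
proof -
  have "Proj (Th F E) n i \<in> Hom (Th F E) n 1"
    unfolding Proj_Th using assms(5) by (intro Hom_ThI) auto
  then show ?thesis
    using theory_morphism_Comp[OF assms(2) _ Hom_ThI[OF assms(3,4)]]
      theory_morphism_Proj[OF assms(2,5)] Comp_Proj_Th[OF assms(1,3,4,5)] by metis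
qed

text \<open>Morphisms preserve projections, so the components of an image are the images of the
  components. Two source theories are allowed because the mediating morphism of the pushout is later
  compared with \<open>q\<close>, which starts at the theory of sets.\<close>

lemma theory_morphism_tuple_eq:
  assumes "lawvere_theory X" "wf_eqns F E" "theory_morphism (Th F E) X p"
    "wf_eqns F' E'" "theory_morphism (Th F' E') X p'"
    "length ts = n" "set ts \<subseteq> trms F m" "length ts' = n" "set ts' \<subseteq> trms F' m"
    "\<And>i. i < n \<Longrightarrow> p m 1 [cls F E m (ts ! i)] = p' m 1 [cls F' E' m (ts' ! i)]"
  shows "p m n (map (cls F E m) ts) = p' m n (map (cls F' E' m) ts')"
proof (rule lawvere_theory_ext[OF assms(1)])
  show "p m n (map (cls F E m) ts) \<in> Hom X m n" "p' m n (map (cls F' E' m) ts') \<in> Hom X m n"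
    using assms by (auto intro: theory_morphism_Hom Hom_ThI)
next
  fix i assume i: "i < n"
  show "Comp X m n 1 (Proj X n i) (p m n (map (cls F E m) ts)) =
      Comp X m n 1 (Proj X n i) (p' m n (map (cls F' E' m) ts'))"
    using theory_morphism_component[OF assms(2,3,6,7) i]
      theory_morphism_component[OF assms(4,5,8,9) i] assms(10)[OF i] by simp
qed

text \<open>A compound term is the basic operation of \<open>f\<close> composed with the pair of its
  arguments. This yields the congruence case when \<open>p\<close> is shown to respect provable
  equality.\<close>

lemma theory_morphism_App:
  assumes "wf_eqns F E" "theory_morphism (Th F E) X p"
    "f \<in> F" "s \<in> trms F m" "t \<in> trms F m"
  shows "p m 1 [cls F E m (App f s t)] =
    Comp X m 2 1 (p 2 1 [cls F E 2 (App f (Var 0) (Var 1))]) (p m 2 [cls F E m s, cls F E m t])"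
proof -
  let ?x = "map (cls F E 2) [App f (Var 0) (Var 1)]" and ?st = "map (cls F E m) [s, t]"
  have x: "?x \<in> Hom (Th F E) 2 1" using assms(3) by (intro Hom_ThI) auto
  have st: "?st \<in> Hom (Th F E) m 2" using assms(4,5) by (intro Hom_ThI) auto
  have "Comp (Th F E) m 2 1 ?x ?st = map (cls F E m) [App f s t]"
    using assms by (subst Comp_Th'[OF assms(1)]) auto
  then show ?thesis using theory_morphism_Comp[OF assms(2) x st] by simp
qed

section \<open>Factoring a morphism through additional equations\<close>

definition identifies ::
  "'f set \<Rightarrow> ('f trm \<times> 'f trm) set \<Rightarrow> (nat \<Rightarrow> nat \<Rightarrow> 'f trm set list \<Rightarrow> 'x) \<Rightarrow>
   ('f trm \<times> 'f trm) set \<Rightarrow> bool"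
where
  "identifies F E p E' \<longleftrightarrow> (\<forall>(l, r)\<in>E'. \<forall>m \<tau>. (\<forall>i. \<tau> i \<in> trms F m) \<longrightarrow>
    p m 1 [cls F E m (subst \<tau> l)] = p m 1 [cls F E m (subst \<tau> r)])"

text \<open>Having equal images under \<open>p\<close> is a congruence on terms, and
  \<open>identifies\<close> puts all substitution instances of \<open>E'\<close> into it. It
  therefore contains the congruence that they generate.\<close>

lemma eqv_imp_theory_morphism_eq:
  assumes X: "lawvere_theory X" and wf: "wf_eqns F E" "wf_eqns F E'"
    and p: "theory_morphism (Th F E) X p"
    and ax: "identifies F E p E'"
    and st: "eqv F E' m s t"
  shows "p m 1 [cls F E m s] = p m 1 [cls F E m t]"
  using st
proof (induction rule: eqv.induct)
  case (ax l r \<sigma>)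
  then show ?case using assms(5) unfolding identifies_def by blast
next
  case (cong f s s' t t')
  have tr: "s \<in> trms F m" "s' \<in> trms F m" "t \<in> trms F m" "t' \<in> trms F m"
    using cong.hyps eqv_trms[OF wf(2)] by blast+
  have "p m 2 (map (cls F E m) [s, t]) = p m 2 (map (cls F E m) [s', t'])"
    using tr cong.IH
    by (intro theory_morphism_tuple_eq[OF X wf(1) p wf(1) p]) (auto simp: less_2_cases_iff)
  then show ?case
    using theory_morphism_App[OF wf(1) p cong.hyps(1) tr(1,3)]
      theory_morphism_App[OF wf(1) p cong.hyps(1) tr(2,4)] by simp
qed auto

text \<open>The factorization of \<open>p\<close> through a further quotient: lift each class to a
  term, take its class for \<open>E\<close>, then apply \<open>p\<close>. The lift is a choice,
  shown harmless in \<open>quotient_mor_cls\<close>.\<close>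

definition quotient_mor ::
  "'f set \<Rightarrow> ('f trm \<times> 'f trm) set \<Rightarrow> (nat \<Rightarrow> nat \<Rightarrow> 'f trm set list \<Rightarrow> 'x) \<Rightarrow>
   nat \<Rightarrow> nat \<Rightarrow> 'f trm set list \<Rightarrow> 'x" where
  "quotient_mor F E p m n cs = p m n (map (\<lambda>c. cls F E m (rep c)) cs)"

lemma quotient_mor_cls:
  assumes X: "lawvere_theory X" and wf: "wf_eqns F E" "wf_eqns F E'"
    and p: "theory_morphism (Th F E) X p"
    and ax: "identifies F E p E'"
    and ts: "length ts = n" "set ts \<subseteq> trms F m"
  shows "quotient_mor F E p m n (map (cls F E' m) ts) = p m n (map (cls F E m) ts)"
proof -
  have "p m n (map (cls F E m) (map (\<lambda>t. rep (cls F E' m t)) ts)) = p m n (map (cls F E m) ts)"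
  proof (rule theory_morphism_tuple_eq[OF X wf(1) p wf(1) p _ _ ts])
    fix i assume i: "i < n"
    then have "ts ! i \<in> trms F m" using ts by auto
    from eqv_imp_theory_morphism_eq[OF X wf p ax eqv.sym[OF rep_cls[OF this]]]
    show "p m 1 [cls F E m (map (\<lambda>t. rep (cls F E' m t)) ts ! i)] = p m 1 [cls F E m (ts ! i)]"
      using i ts by simp
  qed (use ts rep_cls_trms[OF wf(2)] in auto)
  then show ?thesis by (simp add: quotient_mor_def comp_def)
qed

lemma theory_morphism_quotient_mor:
  assumes X: "lawvere_theory X" and wf: "wf_eqns F E" "wf_eqns F E'"
    and p: "theory_morphism (Th F E) X p"
    and ax: "identifies F E p E'"
  shows "theory_morphism (Th F E') X (quotient_mor F E p)"
proof -
  note cl = quotient_mor_cls[OF X wf p ax]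
  show ?thesis
    unfolding theory_morphism_def
  proof (intro conjI allI ballI impI)
    fix m n f assume "f \<in> Hom (Th F E') m n"
    then show "quotient_mor F E p m n f \<in> Hom X m n"
      by (elim Hom_ThE) (simp only: cl, rule theory_morphism_Hom[OF p], rule Hom_ThI)
  next
    fix n
    have "quotient_mor F E p n n (Id (Th F E') n) = p n n (Id (Th F E) n)"
      unfolding Id_Th by (rule cl) auto
    then show "quotient_mor F E p n n (Id (Th F E') n) = Id X n"
      using p by (simp add: theory_morphism_def)
  next
    fix k m n f g assume "f \<in> Hom (Th F E') m n" "g \<in> Hom (Th F E') k m"
    then obtain ts us
      where ts: "length ts = n" "set ts \<subseteq> trms F m" "f = map (cls F E' m) ts"
        and us: "length us = m" "set us \<subseteq> trms F k" "g = map (cls F E' k) us"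
      by (elim Hom_ThE) blast
    \<comment> \<open>Composition in both presented theories is the same substitution on lists of
      terms, so it can be carried out in \<open>Th F E\<close>, where \<open>p\<close> preserves
      it.\<close>
    have "quotient_mor F E p k n (Comp (Th F E') k m n f g) =
        p k n (map (cls F E k) (map (subst (\<lambda>i. us ! i)) ts))"
      unfolding ts(3) us(3) Comp_Th'[OF wf(2) ts(2) us(1,2)]
      using ts by (intro cl subst_nth_trms[OF ts(2) us(1,2)]) auto
    also have "\<dots> = p k n (Comp (Th F E) k m n (map (cls F E m) ts) (map (cls F E k) us))"
      unfolding Comp_Th'[OF wf(1) ts(2) us(1,2)] ..
    also have "\<dots> = Comp X k m n (p m n (map (cls F E m) ts)) (p k m (map (cls F E k) us))"
      by (intro theory_morphism_Comp[OF p] Hom_ThI ts(1,2) us(1,2))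
    finally show "quotient_mor F E p k n (Comp (Th F E') k m n f g) =
        Comp X k m n (quotient_mor F E p m n f) (quotient_mor F E p k m g)"
      unfolding ts(3) us(3) cl[OF ts(1,2)] cl[OF us(1,2)] .
  next
    fix n i assume i: "i < (n::nat)"
    have "quotient_mor F E p n 1 (Proj (Th F E') n i) = p n 1 (Proj (Th F E) n i)"
      unfolding Proj_Th using i by (intro cl) auto
    then show "quotient_mor F E p n 1 (Proj (Th F E') n i) = Proj X n i"
      using theory_morphism_Proj[OF p i] by simp
  qed
qed

section \<open>The pushout squares\<close>

lemma translate_same_interp [simp]: "translate same_interp t = t"
  by (induction t) (auto simp: same_interp_def)

lemma same_interp_ev [simp]: "ev I (\<lambda>i. if i = 0 then x else y) (same_interp f) = I f x y"
  by (simp add: same_interp_def)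

lemma Psi2_interp_ev [simp]:
  "ev I (\<lambda>i. if i = 0 then x else y) (Psi2_interp f) = I f x (I f x y)"
  by (simp add: Psi2_interp_def)

lemma trivial_interp_ev [simp]:
  "ev I (\<lambda>i. if i = 0 then x else y) (trivial_interp f) = y"
  by (simp add: trivial_interp_def)

lemma interp_trms:
  "same_interp f \<in> trms UNIV 2" "Psi2_interp f \<in> trms UNIV 2" "trivial_interp f \<in> trms F 2"
  by (simp_all add: same_interp_def Psi2_interp_def trivial_interp_def)

text \<open>For \<open>Act\<close> this is involutivity. An involution is its own inverse, so
  \<open>ActInv\<close> acts as \<open>Act\<close> does and its square is trivial too.\<close>

lemma involutary_sq_trivial:
  assumes "satisfies A UNIV (insert invol_eqn E) I" "rack_eqns \<subseteq> E" "x \<in> A" "y \<in> A"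
  shows "I f x (I f x y) = y"
proof -
  have "satisfies A UNIV invo_eqns I"
    using assms(1,2) unfolding satisfies_def invo_eqns_def by blast
  then have inv: "involutary_rack A (I Act)"
    and ai: "\<And>x y. x \<in> A \<Longrightarrow> y \<in> A \<Longrightarrow> I ActInv x y = inv_into A (I Act x) y"
    by (auto simp: satisfies_rack_theories)
  then have b: "bij_betw (I Act x) A A" and sq: "I Act x (I Act x y) = y" if "y \<in> A" for y
    using assms(3) that by (auto simp: involutary_rack_def rack_def)
  have "I ActInv x z = I Act x z" if "z \<in> A" for z
    using bij_betw_inv_into_left[OF b[OF that], of "I Act x z"] sq[OF that] ai[OF assms(3) that]
      bij_betw_apply[OF b[OF that] that] by simp
  then show ?thesis using sq[OF assms(4)] bij_betw_apply[OF b[OF assms(4)] assms(4)] assms(4)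
    by (cases f) simp_all
qed

text \<open>Commutativity of the square on terms. By completeness it suffices to look at models,
  where the squared operations and the trivial ones agree.\<close>

lemma translate_Psi2_eqv_trivial:
  assumes "wf_eqns UNIV (insert invol_eqn E)" "rack_eqns \<subseteq> E" "t \<in> trms UNIV m"
  shows "eqv UNIV (insert invol_eqn E) m (translate Psi2_interp t) (translate trivial_interp t)"
proof (rule eqv_complete[OF assms(1)])
  have "translate \<sigma> t \<in> trms UNIV m" if "\<And>f. \<sigma> f \<in> trms UNIV 2" for \<sigma> :: "rack_sym \<Rightarrow> rack_sym trm"
    using translate_trms[of UNIV \<sigma> UNIV] that assms(3) by blast
  then show "translate Psi2_interp t \<in> trms UNIV m" "translate trivial_interp t \<in> trms UNIV m"
    using interp_trms by blast+
next
  fix A :: "rack_sym trm set set" and I v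
  assume sat: "satisfies A UNIV (insert invol_eqn E) I" and v: "\<And>i. i < m \<Longrightarrow> v i \<in> A"
  \<comment> \<open>Membership in \<open>A\<close> is carried along in the induction because
    involutivity is known only for elements of \<open>A\<close>.\<close>
  have "ev (\<lambda>f x y. I f x (I f x y)) v t = ev (\<lambda>f x y. y) v t \<and> ev (\<lambda>f x y. y) v t \<in> A"
    using assms(3)
    by (induction rule: trms.induct) (auto simp: v involutary_sq_trivial[OF sat assms(2)])
  then show "ev I v (translate Psi2_interp t) = ev I v (translate trivial_interp t)"
    by (simp add: ev_translate)
qed

text \<open>Treats racks and quandles at once. What depends on \<open>E\<close> is isolated in
  \<open>t\<close> and \<open>l\<close>: squared and trivial operations again satisfy
  \<open>E\<close>.\<close>

lemma pushout_square_involutory: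
  fixes E :: "(rack_sym trm \<times> rack_sym trm) set"
  assumes wf: "wf_eqns UNIV E" "wf_eqns UNIV (insert invol_eqn E)" and rack: "rack_eqns \<subseteq> E"
    and t: "interprets UNIV E UNIV E Psi2_interp"
    and l: "interprets UNIV E {} {} trivial_interp"
  shows "pushout_square TYPE('x) (Th UNIV E) (Th UNIV E) (Th {} {}) (Th UNIV (insert invol_eqn E))
    (interp_mor UNIV E Psi2_interp) (interp_mor {} {} trivial_interp)
    (interp_mor UNIV (insert invol_eqn E) same_interp)
    (interp_mor UNIV (insert invol_eqn E) same_interp)"
proof -
  let ?E = "insert invol_eqn E"
  have wf0: "wf_eqns {} ({} :: (rack_sym trm \<times> rack_sym trm) set)" by simp
  have mono: "t \<in> trms UNIV m" if "t \<in> trms {} m" for t :: "rack_sym trm" and m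
    using that by (induction rule: trms.induct) auto
  have r: "interprets UNIV E UNIV ?E same_interp" and b: "interprets {} {} UNIV ?E same_interp"
    by (auto simp: interprets_def interp_trms satisfies_def)
  note t_cls = interp_mor_cls[OF wf(1) wf(1) t]
  note l_cls = interp_mor_cls[OF wf(1) wf0 l]
  have r_cls: "interp_mor UNIV ?E same_interp m n (map (cls UNIV E m) ts) = map (cls UNIV ?E m) ts"
    if "set ts \<subseteq> trms UNIV m" for m n ts
    using interp_mor_cls[OF wf r that] by simp
  have b_cls: "interp_mor UNIV ?E same_interp m n (map (cls {} {} m) ts) = map (cls UNIV ?E m) ts"
    if "set ts \<subseteq> trms {} m" for m n ts
    using interp_mor_cls[OF wf0 wf(2) b that] by simp
  show ?thesis
    unfolding pushout_square_def
  proof (intro conjI allI impI)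
    show "lawvere_theory (Th UNIV E)" "lawvere_theory (Th UNIV E)"
      "lawvere_theory (Th {} {} :: rack_sym trm set list law_theory)" "lawvere_theory (Th UNIV ?E)"
      by (intro lawvere_theory_Th wf wf0)+
    show "theory_morphism (Th UNIV E) (Th UNIV E) (interp_mor UNIV E Psi2_interp)"
      by (intro theory_morphism_interp_mor wf wf0 t)
    show "theory_morphism (Th UNIV E) (Th {} {}) (interp_mor {} {} trivial_interp)"
      by (intro theory_morphism_interp_mor wf wf0 l)
    show "theory_morphism (Th UNIV E) (Th UNIV ?E) (interp_mor UNIV ?E same_interp)"
      by (intro theory_morphism_interp_mor wf wf0 r)
    show "theory_morphism (Th {} {}) (Th UNIV ?E) (interp_mor UNIV ?E same_interp)"
      by (intro theory_morphism_interp_mor wf wf0 b)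
    show "mor_eq (Th UNIV E)
        (mor_comp (interp_mor UNIV ?E same_interp) (interp_mor UNIV E Psi2_interp))
        (mor_comp (interp_mor UNIV ?E same_interp) (interp_mor {} {} trivial_interp))"
      unfolding mor_eq_def mor_comp_def
    proof (intro allI ballI)
      fix m n f assume "f \<in> Hom (Th UNIV E) m n"
      then obtain ts where ts: "set ts \<subseteq> trms UNIV m" "f = map (cls UNIV E m) ts"
        by (rule Hom_ThE)
      have 1: "set (map (translate Psi2_interp) ts) \<subseteq> trms UNIV m"
        using ts(1) interprets_trms[OF t] by fastforce
      have 2: "set (map (translate trivial_interp) ts) \<subseteq> trms {} m"
        using ts(1) interprets_trms[OF l] by fastforce
      have "cls UNIV ?E m (translate Psi2_interp t) = cls UNIV ?E m (translate trivial_interp t)"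
        if "t \<in> set ts" for t
        using that ts(1) by (intro cls_eq translate_Psi2_eqv_trivial[OF wf(2) rack]) auto
      then show "interp_mor UNIV ?E same_interp m n (interp_mor UNIV E Psi2_interp m n f) =
          interp_mor UNIV ?E same_interp m n (interp_mor {} {} trivial_interp m n f)"
        unfolding ts(2) t_cls[OF ts(1)] l_cls[OF ts(1)] r_cls[OF 1] b_cls[OF 2] by simp
    qed
  next
    fix X :: "'x law_theory" and p q
    assume a: "lawvere_theory X \<and> theory_morphism (Th UNIV E) X p \<and>
      theory_morphism (Th {} {}) X q \<and>
      mor_eq (Th UNIV E) (mor_comp p (interp_mor UNIV E Psi2_interp))
        (mor_comp q (interp_mor {} {} trivial_interp))"
    then have X: "lawvere_theory X" and p: "theory_morphism (Th UNIV E) X p"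
      and q: "theory_morphism (Th {} {}) X q"
      and pq: "\<And>m n f. f \<in> Hom (Th UNIV E) m n \<Longrightarrow> p m n (interp_mor UNIV E Psi2_interp m n f) =
        q m n (interp_mor {} {} trivial_interp m n f)"
      by (auto simp: mor_eq_def mor_comp_def)
    have sq: "p 2 1 [cls UNIV E 2 (App Act X0 (App Act X0 X1))] = p 2 1 [cls UNIV E 2 X1]"
    proof -
      let ?ts = "[App Act X0 X1]"
      have ts: "set ?ts \<subseteq> trms UNIV 2" by simp
      have "p 2 1 [cls UNIV E 2 (App Act X0 (App Act X0 X1))] = q 2 1 [cls {} {} 2 X1]"
        using pq[OF Hom_ThI[OF _ ts, of 1 E]] unfolding t_cls[OF ts] l_cls[OF ts]
        by (simp add: Psi2_interp_def trivial_interp_def)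
      \<comment> \<open>The class of \<open>X1\<close> is the second projection from
        \<open>2\<close> in both theories, and \<open>p\<close> and \<open>q\<close> send it to the
        same projection of \<open>X\<close>.\<close>
      also have "\<dots> = p 2 1 [cls UNIV E 2 X1]"
        using theory_morphism_Proj[OF q, of 1 2] theory_morphism_Proj[OF p, of 1 2]
        by (simp add: Proj_Th)
      finally show ?thesis .
    qed
    have eq: "p m 1 [cls UNIV E m (subst \<tau> l)] = p m 1 [cls UNIV E m (subst \<tau> r)]"
      if lr: "(l, r) \<in> ?E" and \<tau>: "\<And>i. \<tau> i \<in> trms UNIV m" for l r m \<tau>
    proof (cases "(l, r) \<in> E")
      case True
      then show ?thesis using cls_eq[OF eqv.ax[OF True \<tau>]] by simp
    next
      case False
      \<comment> \<open>Only two variables occur in the involutivity equation, so each instance is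
        its generic form precomposed with the pair of \<open>\<tau> 0\<close> and
        \<open>\<tau> 1\<close>. Thus \<open>sq\<close> yields all instances.\<close>
      have "p m 1 [cls UNIV E m (subst \<tau> t)] =
          Comp X m 2 1 (p 2 1 [cls UNIV E 2 t]) (p m 2 [cls UNIV E m (\<tau> 0), cls UNIV E m (\<tau> 1)])"
        if t: "t \<in> trms UNIV 2" for t
      proof -
        have ts: "set [t] \<subseteq> trms UNIV 2" and us: "set [\<tau> 0, \<tau> 1] \<subseteq> trms UNIV m"
          using t \<tau> by auto
        have "subst (\<lambda>i. [\<tau> 0, \<tau> 1] ! i) t = subst \<tau> t"
          by (rule subst_cong[OF t]) (auto simp: less_2_cases_iff)
        then have "Comp (Th UNIV E) m 2 1 (map (cls UNIV E 2) [t])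
            (map (cls UNIV E m) [\<tau> 0, \<tau> 1]) = [cls UNIV E m (subst \<tau> t)]"
          by (subst Comp_Th'[OF wf(1) ts _ us]) auto
        then show ?thesis
          using theory_morphism_Comp[OF p Hom_ThI[OF _ ts] Hom_ThI[OF _ us], of 1] by simp
      qed
      moreover have "l = App Act X0 (App Act X0 X1)" "r = X1"
        using False lr by (auto simp: invol_eqn_def)
      ultimately show ?thesis using sq by (metis (full_types) UNIV_I trms_iff one_less_numeral_iff
            semiring_norm(76) zero_less_numeral)
    qed
    have ax: "identifies UNIV E p ?E" unfolding identifies_def using eq by blast
    let ?u = "quotient_mor UNIV E p"
    have u: "theory_morphism (Th UNIV ?E) X ?u"
      by (rule theory_morphism_quotient_mor[OF X wf p ax])
    have "mor_eq (Th UNIV E) (mor_comp ?u (interp_mor UNIV ?E same_interp)) p"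
      unfolding mor_eq_def mor_comp_def
      by (auto elim!: Hom_ThE simp: r_cls quotient_mor_cls[OF X wf p ax])
    moreover have "mor_eq (Th {} {}) (mor_comp ?u (interp_mor UNIV ?E same_interp)) q"
      unfolding mor_eq_def mor_comp_def
    proof (intro allI ballI)
      fix m n f assume "f \<in> Hom (Th {} ({} :: (rack_sym trm \<times> rack_sym trm) set)) m n"
      then obtain ts where ts: "length ts = n" "set ts \<subseteq> trms {} m" "f = map (cls {} {} m) ts"
        by (rule Hom_ThE)
      have "?u m n (map (cls UNIV ?E m) ts) = q m n (map (cls {} {} m) ts)"
      proof (rule theory_morphism_tuple_eq[OF X wf(2) u wf0 q ts(1) _ ts(1,2)])
        show "set ts \<subseteq> trms UNIV m" using ts(2) mono by blast
        fix i assume "i < n"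
        then have "ts ! i \<in> trms {} m" using ts by auto
        \<comment> \<open>Over the empty signature every term is a variable. Its class is a
          projection, which \<open>?u\<close> and \<open>q\<close> both preserve.\<close>
        then obtain j where "ts ! i = Var j" "j < m" by cases auto
        then show "?u m 1 [cls UNIV ?E m (ts ! i)] = q m 1 [cls {} {} m (ts ! i)]"
          using theory_morphism_Proj[OF u, of j m] theory_morphism_Proj[OF q, of j m]
          by (simp add: Proj_Th)
      qed
      then show "?u m n (interp_mor UNIV ?E same_interp m n f) = q m n f"
        unfolding ts(3) b_cls[OF ts(2)] .
    qed
    \<comment> \<open>Uniqueness: every arrow of \<open>Th UNIV ?E\<close> is the image of an arrow
      of \<open>Th UNIV E\<close>, so the triangle over \<open>p\<close> fixes
      \<open>v\<close>.\<close>
    moreover have "mor_eq (Th UNIV ?E) v ?u"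
      if "mor_eq (Th UNIV E) (mor_comp v (interp_mor UNIV ?E same_interp)) p" for v
      unfolding mor_eq_def
    proof (intro allI ballI)
      fix m n f assume "f \<in> Hom (Th UNIV ?E) m n"
      then obtain ts where ts: "length ts = n" "set ts \<subseteq> trms UNIV m" "f = map (cls UNIV ?E m) ts"
        by (rule Hom_ThE)
      have "v m n (interp_mor UNIV ?E same_interp m n (map (cls UNIV E m) ts)) =
          p m n (map (cls UNIV E m) ts)"
        using that Hom_ThI[OF ts(1,2), of E] unfolding mor_eq_def mor_comp_def by blast
      then show "v m n f = ?u m n f"
        unfolding ts(3) r_cls[OF ts(2)] quotient_mor_cls[OF X wf p ax ts(1,2)] .
    qed
    ultimately show "\<exists>u. theory_morphism (Th UNIV ?E) X u \<and>
        mor_eq (Th UNIV E) (mor_comp u (interp_mor UNIV ?E same_interp)) p \<and>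
        mor_eq (Th {} {}) (mor_comp u (interp_mor UNIV ?E same_interp)) q \<and>
        (\<forall>v. theory_morphism (Th UNIV ?E) X v \<and>
          mor_eq (Th UNIV E) (mor_comp v (interp_mor UNIV ?E same_interp)) p \<and>
          mor_eq (Th {} {}) (mor_comp v (interp_mor UNIV ?E same_interp)) q \<longrightarrow>
          mor_eq (Th UNIV ?E) v u)"
      using u by blast
  qed
qed

section \<open>Squared and trivial structures on racks and quandles\<close>

lemma rack_sq:
  assumes "rack A b"
  shows "rack A (\<lambda>x y. b x (b x y))"
proof -
  have in_A: "b x y \<in> A" if "x \<in> A" "y \<in> A" for x y
    using assms that by (auto simp: rack_def bij_betw_apply)
  have "bij_betw (\<lambda>y. b x (b x y)) A A" if "x \<in> A" for x
    using assms that bij_betw_trans[of "b x" A A "b x" A] by (simp add: rack_def comp_def)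
  moreover have d: "b x (b y z) = b (b x y) (b x z)" if "x \<in> A" "y \<in> A" "z \<in> A" for x y z
    using assms that unfolding rack_def by blast
  \<comment> \<open>Left multiplication by \<open>x\<close> preserves \<open>b\<close>, hence so
    does its square, which therefore preserves the squared operation as well. The simplifier pulls
    \<open>b x\<close> outwards on the right-hand side.\<close>
  have "b x (b x (b y (b y z))) = b (b x (b x y)) (b (b x (b x y)) (b x (b x z)))"
    if "x \<in> A" "y \<in> A" "z \<in> A" for x y z
    using that in_A by (simp flip: d)
  ultimately show ?thesis by (simp add: rack_def)
qed

text \<open>The inverse of a squared left multiplication is the square of the inverse, so squaring
  both symbols keeps \<open>ActInv\<close> inverse to \<open>Act\<close>.\<close>

lemma satisfies_rack_sq:
  assumes "satisfies A UNIV rack_eqns I"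
  shows "satisfies A UNIV rack_eqns (\<lambda>f x y. I f x (I f x y))"
proof -
  have I: "rack A (I Act)" "\<And>x y. x \<in> A \<Longrightarrow> y \<in> A \<Longrightarrow> I ActInv x y = inv_into A (I Act x) y"
    using assms by (auto simp: satisfies_rack)
  have "I ActInv x (I ActInv x y) = inv_into A (\<lambda>z. I Act x (I Act x z)) y"
    if xy: "x \<in> A" "y \<in> A" for x y
  proof -
    have "I ActInv x y \<in> A" using assms xy by (simp add: satisfies_def)
    then show ?thesis using I xy inv_into_sq[of "I Act x" A y] by (simp add: rack_def)
  qed
  then show ?thesis using I(1) by (simp add: satisfies_rack rack_sq)
qed

lemma satisfies_rack_trivial: "satisfies A UNIV rack_eqns (\<lambda>f x y. y)"
  by (auto simp: satisfies_def rack_eqns_def)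

text \<open>Splitting off idempotence lets the rack facts be reused: it passes from an operation to
  its square and holds for the trivial operation.\<close>

lemma satisfies_quandle_iff:
  "satisfies A UNIV quandle_eqns I \<longleftrightarrow> satisfies A UNIV rack_eqns I \<and> (\<forall>x\<in>A. I Act x x = x)"
  by (auto simp: satisfies_rack_theories satisfies_rack quandle_def)

lemma rack_subset_quandle: "rack_eqns \<subseteq> quandle_eqns"
  by (auto simp: quandle_eqns_def)

theorem theorem6p3:
  shows "pushout_square TYPE('x) Rack_th Rack_th Sets_th Invo_th
           Psi2_Rack triv_mor incl_Invo struct_Invo \<and>
         pushout_square TYPE('x) Quan_th Quan_th Sets_th Kei_th
           Psi2_Quan triv_mor incl_Kei struct_Kei"
proof
  show "pushout_square TYPE('x) Rack_th Rack_th Sets_th Invo_th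
      Psi2_Rack triv_mor incl_Invo struct_Invo"
    unfolding Rack_th_def Sets_th_def Invo_th_def Psi2_Rack_def triv_mor_def incl_Invo_def
      struct_Invo_def invo_eqns_def
    \<comment> \<open>Folding \<open>invo_eqns\<close> back in the side conditions makes
      \<open>wf_rack\<close> applicable.\<close>
    by (rule pushout_square_involutory)
      (simp_all add: interprets_def interp_trms satisfies_rack_sq satisfies_rack_trivial
        flip: invo_eqns_def)
  show "pushout_square TYPE('x) Quan_th Quan_th Sets_th Kei_th
      Psi2_Quan triv_mor incl_Kei struct_Kei"
    unfolding Quan_th_def Sets_th_def Kei_th_def Psi2_Quan_def triv_mor_def incl_Kei_def
      struct_Kei_def kei_eqns_def
    by (rule pushout_square_involutory)
      (simp_all add: interprets_def interp_trms satisfies_quandle_iff satisfies_rack_sq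
        satisfies_rack_trivial rack_subset_quandle flip: kei_eqns_def)
qed

end
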